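(* Let $N\ge 2$ and let $A,\Omega\subset\mathbb{R}^N$ be bounded open sets with $\overline{A}\subset\Omega$ such that $A$ has Lipschitz boundary. Let $\sigma$ be the surface measure on $\partial A$ and let $n$ be the unit normal vector field on $\partial A$ oriented outwards from $A$ (defined $\sigma$-almost everywhere). For each $a>0$ let $s_a\in H_0^1(\Omega)^N$ be the unique element satisfying $$a\int_\Omega(\nabla s_a:\nabla\varphi)\,dx+\int_{\Omega\setminus A}(s_a,\varphi)\,dx=\int_{\partial A}(n,\varphi)\,d\sigma\qquad\text{for all }\varphi\in H_0^1(\Omega)^N.$$ Then $$\lim_{a\to0^+}\int_{\Omega\setminus A}(s_a,\varphi)\,dx=\int_{\partial A}(n,\varphi)\,d\sigma\qquad\text{for all }\varphi\in H_0^1(\Omega)^N.$$ Moreover, $a s_a\to 0$ strongly in $H_0^1(\Omega)^N$ as $a\to0^+$.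
   Context: "$A$ has Lipschitz boundary" means: for each $x\in\partial A$ there is a neighborhood $U\subset\mathbb{R}^N$ of $x$ such that, in some orthogonal coordinate system, $\partial A\cap U$ is the graph of a Lipschitz function (of $N-1$ variables), with $A\cap U$ being the part of $U$ lying on one side of this graph. $(\cdot,\cdot)$ is the standard inner product of $\mathbb{R}^N$ and $(P:Q)=\mathrm{Tr}(P^TQ)$ is the Hilbert-Schmidt inner product of matrices. $H_0^1(\Omega)^N$ is the space of $\mathbb{R}^N$-valued functions with components in $H_0^1(\Omega)$, with inner product $\langle\varphi,\psi\rangle_{H_0^1(\Omega)^N}=\int_\Omega(\nabla\varphi:\nabla\psi)\,dx=\sum_{i,j=1}^N\langle\partial_{x_i}\varphi_j,\partial_{x_i}\psi_j\rangle_{L^2(\Omega)}$. In integrals over $\partial A$, $\varphi$ denotes its trace on $\partial A$; the trace map $H_0^1(\Omega)^N\to L^2(\partial A)^N$ is bounded. Existence and uniqueness of $s_a$ follow from the Lax-Milgram theorem. *)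

theory Defs
  imports "HOL-Analysis.Analysis"
begin

section \<open>Bounded Lipschitz domains\<close>

definition hproj :: "real ^ 'n \<Rightarrow> real ^ 'n \<Rightarrow> real ^ 'n"
  where "hproj e x = x - (x \<bullet> e) *\<^sub>R e"

text \<open>An orthogonal coordinate system is represented by the unit vector \<open>e\<close> along its last axis:
  the first \<open>N - 1\<close> coordinates of \<open>x\<close> are those of \<open>hproj e x\<close> in the hyperplane
  orthogonal to \<open>e\<close> (the choice of axes there is immaterial), and the last one is \<open>x \<bullet> e\<close>.
  A function of \<open>N - 1\<close> variables is thus a function \<open>\<gamma>\<close> on that hyperplane; its values
  elsewhere are never used. That \<open>A\<close> lies below the graph is no restriction: replace
  \<open>e, \<gamma>\<close> by \<open>- e, - \<gamma>\<close>.\<close>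

definition lipschitz_chart ::
    "(real ^ 'n) set \<Rightarrow> (real ^ 'n) set \<Rightarrow> real ^ 'n \<Rightarrow> (real ^ 'n \<Rightarrow> real) \<Rightarrow> bool"
  where "lipschitz_chart A U e \<gamma> \<longleftrightarrow>
    open U \<and> norm e = 1 \<and>
    (\<exists>L. L-lipschitz_on {y. y \<bullet> e = 0} \<gamma>) \<and>
    frontier A \<inter> U = {x \<in> U. x \<bullet> e = \<gamma> (hproj e x)} \<and>
    A \<inter> U = {x \<in> U. x \<bullet> e < \<gamma> (hproj e x)}"

definition lipschitz_boundary :: "(real ^ 'n) set \<Rightarrow> bool"
  where "lipschitz_boundary A \<longleftrightarrow>
    (\<forall>x \<in> frontier A. \<exists>U e \<gamma>. x \<in> U \<and> lipschitz_chart A U e \<gamma>)"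

section \<open>Surface measure and outward unit normal\<close>

definition partial_deriv :: "'n \<Rightarrow> (real ^ 'n \<Rightarrow> real) \<Rightarrow> real ^ 'n \<Rightarrow> real"
  where "partial_deriv i f x = frechet_derivative f (at x) (axis i 1)"

definition gradient :: "(real ^ 'n \<Rightarrow> real) \<Rightarrow> real ^ 'n \<Rightarrow> real ^ 'n"
  where "gradient f x = (\<chi> i. partial_deriv i f x)"

text \<open>The integral of \<open>f\<close> over the hyperplane orthogonal to the unit vector \<open>e\<close> with respect to
  \<open>(N - 1)\<close>-dimensional Lebesgue measure: by Fubini it equals the integral of \<open>f \<circ> hproj e\<close>
  over the slab of height one above the hyperplane.\<close>

definition hyperplane_nn_integral :: "real ^ 'n \<Rightarrow> (real ^ 'n \<Rightarrow> ennreal) \<Rightarrow> ennreal"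
  where "hyperplane_nn_integral e f =
    (\<integral>\<^sup>+ x. f (hproj e x) * indicator {x. 0 \<le> x \<bullet> e \<and> x \<bullet> e \<le> 1} x \<partial>lborel)"

text \<open>The surface measure is the Borel measure carried by the boundary which in every chart is
  given by the area element \<open>sqrt (1 + |\<nabla>\<gamma>|\<^sup>2)\<close>. When the boundary is Lipschitz, it exists and
  these conditions determine it uniquely. The gradient of \<open>\<gamma> \<circ> hproj e\<close> at a point of
  the hyperplane is the gradient of \<open>\<gamma>\<close> with respect to its \<open>N - 1\<close> variables, the component
  along \<open>e\<close> being zero. It exists almost everywhere by Rademacher's theorem.\<close>

definition is_surface_measure :: "(real ^ 'n) set \<Rightarrow> (real ^ 'n) measure \<Rightarrow> bool"
  where "is_surface_measure A \<sigma> \<longleftrightarrow>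
    sets \<sigma> = sets borel \<and>
    emeasure \<sigma> (- frontier A) = 0 \<and>
    (\<forall>U e \<gamma>. lipschitz_chart A U e \<gamma> \<longrightarrow>
      (\<forall>E \<in> sets borel. E \<subseteq> frontier A \<inter> U \<longrightarrow>
        emeasure \<sigma> E = hyperplane_nn_integral e
          (\<lambda>y. indicator E (y + \<gamma> y *\<^sub>R e) *
               ennreal (sqrt (1 + (norm (gradient (\<gamma> \<circ> hproj e) y))\<^sup>2)))))"

text \<open>The first limit says that the hyperplane orthogonal to \<open>\<nu>\<close> is tangent to the boundary at
  \<open>x\<close>; the second condition fixes the orientation.\<close>

definition is_outward_unit_normal :: "(real ^ 'n) set \<Rightarrow> real ^ 'n \<Rightarrow> real ^ 'n \<Rightarrow> bool"
  where "is_outward_unit_normal A x \<nu> \<longleftrightarrow>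
    norm \<nu> = 1 \<and>
    ((\<lambda>y. ((y - x) \<bullet> \<nu>) / norm (y - x)) \<longlongrightarrow> 0) (at x within frontier A) \<and>
    (\<forall>\<^sub>F t in at_right 0. x - t *\<^sub>R \<nu> \<in> A \<and> x + t *\<^sub>R \<nu> \<notin> closure A)"

definition is_outward_normal_field ::
    "(real ^ 'n) set \<Rightarrow> (real ^ 'n) measure \<Rightarrow> (real ^ 'n \<Rightarrow> real ^ 'n) \<Rightarrow> bool"
  where "is_outward_normal_field A \<sigma> n \<longleftrightarrow>
    n \<in> borel_measurable \<sigma> \<and> (AE x in \<sigma>. is_outward_unit_normal A x (n x))"

section \<open>Sobolev spaces\<close>

text \<open>Elements of Lebesgue and Sobolev spaces are represented by functions on the whole space, of
  which only the values almost everywhere in \<open>\<Omega>\<close> matter.\<close>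

primrec Ck :: "nat \<Rightarrow> (real ^ 'n \<Rightarrow> real) \<Rightarrow> bool"
  where
    "Ck 0 f \<longleftrightarrow> continuous_on UNIV f"
  | "Ck (Suc k) f \<longleftrightarrow> (\<forall>x. f differentiable (at x)) \<and> (\<forall>i. Ck k (partial_deriv i f))"

definition test_functions :: "(real ^ 'n) set \<Rightarrow> (real ^ 'n \<Rightarrow> real) set"
  where "test_functions \<Omega> =
    {\<phi>. (\<forall>k. Ck k \<phi>) \<and> (\<exists>K. compact K \<and> K \<subseteq> \<Omega> \<and> (\<forall>x. x \<notin> K \<longrightarrow> \<phi> x = 0))}"

definition L2 :: "'a measure \<Rightarrow> ('a \<Rightarrow> real) set"
  where "L2 M = {f \<in> borel_measurable M. integrable M (\<lambda>x. (f x)\<^sup>2)}"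

definition has_weak_partial ::
    "(real ^ 'n) set \<Rightarrow> 'n \<Rightarrow> (real ^ 'n \<Rightarrow> real) \<Rightarrow> (real ^ 'n \<Rightarrow> real) \<Rightarrow> bool"
  where "has_weak_partial \<Omega> i u v \<longleftrightarrow>
    (\<forall>\<phi> \<in> test_functions \<Omega>.
      (\<integral>x. u x * partial_deriv i \<phi> x \<partial>lebesgue_on \<Omega>) = - (\<integral>x. v x * \<phi> x \<partial>lebesgue_on \<Omega>))"

definition H1 :: "(real ^ 'n) set \<Rightarrow> (real ^ 'n \<Rightarrow> real) set"
  where "H1 \<Omega> =
    {u \<in> L2 (lebesgue_on \<Omega>). \<forall>i. \<exists>v \<in> L2 (lebesgue_on \<Omega>). has_weak_partial \<Omega> i u v}"

definition weak_partial ::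
    "(real ^ 'n) set \<Rightarrow> 'n \<Rightarrow> (real ^ 'n \<Rightarrow> real) \<Rightarrow> real ^ 'n \<Rightarrow> real"
  where "weak_partial \<Omega> i u = (SOME v. v \<in> L2 (lebesgue_on \<Omega>) \<and> has_weak_partial \<Omega> i u v)"

definition H1_norm :: "(real ^ 'n) set \<Rightarrow> (real ^ 'n \<Rightarrow> real) \<Rightarrow> real"
  where "H1_norm \<Omega> u =
    sqrt ((\<integral>x. (u x)\<^sup>2 \<partial>lebesgue_on \<Omega>) +
          (\<Sum>i\<in>UNIV. \<integral>x. (weak_partial \<Omega> i u x)\<^sup>2 \<partial>lebesgue_on \<Omega>))"

definition H1_tendsto ::
    "(real ^ 'n) set \<Rightarrow> (nat \<Rightarrow> real ^ 'n \<Rightarrow> real) \<Rightarrow> (real ^ 'n \<Rightarrow> real) \<Rightarrow> bool"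
  where "H1_tendsto \<Omega> \<phi> u \<longleftrightarrow> (\<lambda>k. H1_norm \<Omega> (\<lambda>x. \<phi> k x - u x)) \<longlonglongrightarrow> 0"

definition H10 :: "(real ^ 'n) set \<Rightarrow> (real ^ 'n \<Rightarrow> real) set"
  where "H10 \<Omega> =
    {u \<in> H1 \<Omega>. \<exists>\<phi>. (\<forall>k. \<phi> k \<in> test_functions \<Omega>) \<and> H1_tendsto \<Omega> \<phi> u}"

definition H10_vec :: "(real ^ 'n) set \<Rightarrow> (real ^ 'n \<Rightarrow> real ^ 'n) set"
  where "H10_vec \<Omega> = {u. \<forall>j. (\<lambda>x. u x $ j) \<in> H10 \<Omega>}"

definition weak_grad ::
    "(real ^ 'n) set \<Rightarrow> (real ^ 'n \<Rightarrow> real ^ 'n) \<Rightarrow> real ^ 'n \<Rightarrow> real ^ 'n ^ 'n"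
  where "weak_grad \<Omega> u x = (\<chi> i j. weak_partial \<Omega> i (\<lambda>y. u y $ j) x)"

definition hs_inner :: "real ^ 'n ^ 'n \<Rightarrow> real ^ 'n ^ 'n \<Rightarrow> real"
  where "hs_inner P Q = trace (transpose P ** Q)"

definition H10_inner ::
    "(real ^ 'n) set \<Rightarrow> (real ^ 'n \<Rightarrow> real ^ 'n) \<Rightarrow> (real ^ 'n \<Rightarrow> real ^ 'n) \<Rightarrow> real"
  where "H10_inner \<Omega> u v =
    (\<integral>x. hs_inner (weak_grad \<Omega> u x) (weak_grad \<Omega> v x) \<partial>lebesgue_on \<Omega>)"

definition H10_norm :: "(real ^ 'n) set \<Rightarrow> (real ^ 'n \<Rightarrow> real ^ 'n) \<Rightarrow> real"
  where "H10_norm \<Omega> u = sqrt (H10_inner \<Omega> u u)"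

section \<open>Traces\<close>

text \<open>The trace map is the extension by continuity, from test functions to \<open>H10 \<Omega>\<close>, of the
  restriction to the boundary that carries \<open>\<sigma>\<close>; it is determined \<open>\<sigma>\<close>-almost everywhere.\<close>

definition has_boundary_trace ::
    "(real ^ 'n) set \<Rightarrow> (real ^ 'n) measure \<Rightarrow> (real ^ 'n \<Rightarrow> real) \<Rightarrow> (real ^ 'n \<Rightarrow> real) \<Rightarrow> bool"
  where "has_boundary_trace \<Omega> \<sigma> u g \<longleftrightarrow>
    g \<in> L2 \<sigma> \<and>
    (\<forall>\<phi>. (\<forall>k. \<phi> k \<in> test_functions \<Omega>) \<and> H1_tendsto \<Omega> \<phi> u \<longrightarrow>
      (\<lambda>k. \<integral>x. (\<phi> k x - g x)\<^sup>2 \<partial>\<sigma>) \<longlonglongrightarrow> 0)"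

definition boundary_trace ::
    "(real ^ 'n) set \<Rightarrow> (real ^ 'n) measure \<Rightarrow> (real ^ 'n \<Rightarrow> real) \<Rightarrow> real ^ 'n \<Rightarrow> real"
  where "boundary_trace \<Omega> \<sigma> u = (SOME g. has_boundary_trace \<Omega> \<sigma> u g)"

definition boundary_trace_vec ::
    "(real ^ 'n) set \<Rightarrow> (real ^ 'n) measure \<Rightarrow> (real ^ 'n \<Rightarrow> real ^ 'n) \<Rightarrow> real ^ 'n \<Rightarrow> real ^ 'n"
  where "boundary_trace_vec \<Omega> \<sigma> u x = (\<chi> j. boundary_trace \<Omega> \<sigma> (\<lambda>y. u y $ j) x)"

end

(* Set F(phi) := int n . tr phi dsigma and D := Omega - A. The equation at a = 1 says that F is the
   H1-bounded functional phi |-> <s_1, phi> + (s_1, phi)_{L2(D)}, so no trace theorem is needed for its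
   boundedness. F vanishes on test functions phi supported in A, because phi and 0 then have the same
   boundary traces.
   The key estimate is that for every eps there is C with |F phi| <= eps |grad phi| + C |phi|_{L2(D)}
   on H10. By density it is enough to consider test functions. Approximating s_1 in H1 by test functions
   and integrating by parts, F is L2-bounded up to eps times the H1 norm. Localise phi with smooth cutoffs
   in small balls; in a boundary ball write
   phi = (phi - phi_t) + eta phi_t + (1 - eta) phi_t with phi_t(x) = phi(x + t e), where e points along the
   graph axis out of A and eta is a cutoff supported in A equal to 1 on the translate by -t e of the
   relevant part of closure A. The first term is small by continuity of translations, F vanishes on the
   second, and the third has L2 norm at most |phi|_{L2(D)}.
   Testing the equation with s_a gives a X^2 + Y^2 <= eps X + C Y for X = |grad s_a| and
   Y = |s_a|_{L2(D)}, hence a X <= eps + C sqrt(a) / 2, which gives both claims. *)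
theory Submission
  imports Defs
begin

section \<open>Calculus of smooth functions\<close>

text \<open>The zero-order term of the equation sees \<open>s a\<close> only outside
  \<open>A\<close>, and \<open>F\<close> is bounded only in the H1 norm. Plain boundedness of
  \<open>F\<close> would give no more than boundedness of \<open>a X\<close>; the gain to
  convergence has to come from the vanishing of \<open>F\<close> on test functions of
  \<open>A\<close>. For Lipschitz \<open>A\<close>, an H10 function that vanishes outside
  \<open>A\<close> is an H1 limit of such test functions, so \<open>F\<close> depends only on the
  restriction of its argument to D. The key estimate is the quantitative form of this fact. In a
  boundary ball, \<open>phi_t\<close> need not be close to \<open>phi\<close> in H1 uniformly in
  \<open>phi\<close>. What is really translated is a smooth density that approximates
  \<open>F\<close>: it is one fixed, uniformly continuous function, and a change of variables moves
  the shift onto it. The cutoff eta depends on this shift and may inflate the H1 norm by a large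
  factor, so the third term is treated with a second, finer approximation of \<open>F\<close>,
  chosen only after eta.\<close>

lemma partial_deriv_eq: "(f has_derivative f') (at x) \<Longrightarrow> partial_deriv i f x = f' (axis i 1)"
  unfolding partial_deriv_def using frechet_derivative_at by fastforce

lemma differentiable_has_derivative:
  "f differentiable at x \<Longrightarrow> (f has_derivative frechet_derivative f (at x)) (at x)"
  using frechet_derivative_works by blast

lemma partial_deriv_const [simp]: "partial_deriv i (\<lambda>x. c) = (\<lambda>x. 0)"
  by (rule ext, subst partial_deriv_eq[OF has_derivative_const]) simp

lemma partial_deriv_add:
  assumes "f differentiable at x" "g differentiable at x"
  shows "partial_deriv i (\<lambda>x. f x + g x) x = partial_deriv i f x + partial_deriv i g x"
  by (subst partial_deriv_eq[OF has_derivative_add[OF assms[THEN differentiable_has_derivative]]])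
    (simp add: partial_deriv_def)

lemma partial_deriv_mult:
  assumes "f differentiable at x" "g differentiable at x"
  shows "partial_deriv i (\<lambda>x. f x * g x) x = f x * partial_deriv i g x + partial_deriv i f x * g x"
  by (subst partial_deriv_eq[OF has_derivative_mult[OF assms[THEN differentiable_has_derivative]]])
    (simp add: partial_deriv_def)

lemma partial_deriv_translate:
  assumes "f differentiable at (x + v)"
  shows "partial_deriv i (\<lambda>x. f (x + v)) x = partial_deriv i f (x + v)"
proof -
  have "((\<lambda>x. x + v) has_derivative (\<lambda>h. h)) (at x)" by (auto intro!: derivative_eq_intros)
  from has_derivative_compose[OF this differentiable_has_derivative[OF assms]]
  show ?thesis by (subst partial_deriv_eq) (auto simp: partial_deriv_def)
qed

lemma partial_deriv_chain:
  assumes "f differentiable at x" "(h has_real_derivative h') (at (f x))"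
  shows "partial_deriv i (\<lambda>x. h (f x)) x = h' * partial_deriv i f x"
proof -
  from has_derivative_compose[OF differentiable_has_derivative[OF assms(1)]
      assms(2)[unfolded has_field_derivative_def]]
  show ?thesis by (subst partial_deriv_eq) (auto simp: partial_deriv_def)
qed

lemma Ck_imp_continuous: "Ck k f \<Longrightarrow> continuous_on UNIV f"
  by (cases k) (simp_all add: differentiable_imp_continuous_on differentiable_on_def)

lemma Ck_Suc_imp: "Ck (Suc k) f \<Longrightarrow> Ck k f"
proof (induction k arbitrary: f)
  case 0
  then show ?case using Ck_imp_continuous[of "Suc 0" f] by simp
next
  case (Suc k)
  have "Ck k (partial_deriv i f)" for i
    using Suc.IH[of "partial_deriv i f"] Suc.prems Ck.simps(2)[of "Suc k" f] by blast
  then show ?case using Suc.prems by simp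
qed

lemma Ck_const [simp]: "Ck k (\<lambda>x. c)"
  by (induction k arbitrary: c) auto

lemma Ck_add: "Ck k f \<Longrightarrow> Ck k g \<Longrightarrow> Ck k (\<lambda>x. f x + g x)"
proof (induction k arbitrary: f g)
  case 0
  then show ?case by (auto intro: continuous_intros)
next
  case (Suc k)
  have "partial_deriv i (\<lambda>x. f x + g x) = (\<lambda>x. partial_deriv i f x + partial_deriv i g x)" for i
    using Suc.prems by (auto simp: partial_deriv_add)
  then show ?case using Suc by auto
qed

lemma Ck_mult: "Ck k f \<Longrightarrow> Ck k g \<Longrightarrow> Ck k (\<lambda>x. f x * g x)"
proof (induction k arbitrary: f g)
  case 0
  then show ?case by (auto intro: continuous_intros)
next
  case (Suc k)
  have "partial_deriv i (\<lambda>x. f x * g x) = (\<lambda>x. f x * partial_deriv i g x + partial_deriv i f x * g x)" for i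
    using Suc.prems by (auto simp: partial_deriv_mult)
  then show ?case using Suc.IH Ck_Suc_imp[OF Suc.prems(1)] Ck_Suc_imp[OF Suc.prems(2)] Suc.prems
    by (auto intro!: Ck_add)
qed

lemma Ck_cmult: "Ck k f \<Longrightarrow> Ck k (\<lambda>x. c * f x)"
  by (rule Ck_mult) auto

lemma Ck_diff: "Ck k f \<Longrightarrow> Ck k g \<Longrightarrow> Ck k (\<lambda>x. f x - g x)"
  using Ck_add[of k f "\<lambda>x. -1 * g x"] Ck_cmult[of k g "-1"] by simp

lemma Ck_sum: "(\<And>i. i \<in> I \<Longrightarrow> Ck k (f i)) \<Longrightarrow> Ck k (\<lambda>x. \<Sum>i\<in>I. f i x)"
  by (induction I rule: infinite_finite_induct) (auto intro: Ck_add)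

lemma Ck_prod: "(\<And>i. i \<in> I \<Longrightarrow> Ck k (f i)) \<Longrightarrow> Ck k (\<lambda>x. \<Prod>i\<in>I. f i x)"
  by (induction I rule: infinite_finite_induct) (auto intro: Ck_mult)

lemma Ck_translate: "Ck k f \<Longrightarrow> Ck k (\<lambda>x. f (x + v))"
proof (induction k arbitrary: f)
  case 0
  then show ?case
    using continuous_on_compose2[of UNIV f UNIV "\<lambda>x. x + v"] by (simp add: continuous_on_add)
next
  case (Suc k)
  have "partial_deriv i (\<lambda>x. f (x + v)) = (\<lambda>x. partial_deriv i f (x + v))" for i
    using Suc.prems by (auto simp: partial_deriv_translate)
  moreover have "(\<lambda>x. f (x + v)) differentiable at x" for x
    using Suc.prems by (intro differentiable_compose[of f "\<lambda>x. x + v"]) simp_all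
  ultimately show ?case using Suc by auto
qed

text \<open>\<open>Ck\<close> speaks only of functions on \<open>real ^ 'n\<close>, so smoothness of
  the outer real function is encoded by the sequence \<open>h\<close> of its successive derivatives.
  The induction needs the claim for all \<open>m\<close>, since differentiation passes from
  \<open>h m\<close> to \<open>h (Suc m)\<close>.\<close>

lemma Ck_chain:
  fixes h :: "nat \<Rightarrow> real \<Rightarrow> real"
  assumes "\<And>m t. (h m has_real_derivative h (Suc m) t) (at t)" and "\<And>k. Ck k f"
  shows "Ck k (\<lambda>x. h m (f x))"
proof (induction k arbitrary: m)
  case 0
  have "continuous_on UNIV (h m)" 
    using assms(1) by (intro DERIV_continuous_on) (rule has_field_derivative_at_within)
  then show ?case using assms(2)[of 0]
    using continuous_on_compose2[of UNIV "h m" UNIV f] by simp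
next
  case (Suc k)
  have d: "f differentiable at x" for x using assms(2)[of "Suc 0"] by simp
  have "partial_deriv i (\<lambda>x. h m (f x)) = (\<lambda>x. h (Suc m) (f x) * partial_deriv i f x)" for i
    by (rule ext, rule partial_deriv_chain[OF d assms(1)])
  moreover have "(\<lambda>x. h m (f x)) differentiable at x" for x
    by (intro differentiable_compose[of "h m" f] d)
       (use assms(1)[THEN has_field_derivative_imp_has_derivative] in \<open>auto simp: differentiable_def\<close>)
  moreover have "Ck k (partial_deriv i f)" for i using assms(2)[of "Suc k"] by simp
  ultimately show ?case using Suc by (simp add: Ck_mult)
qed

text \<open>The derivative of \<open>1 / f\<close> is \<open>- 1 / f^2\<close> times that of
  \<open>f\<close>, a product of factors already known to be \<open>Ck k\<close>, so the induction
  on \<open>k\<close> closes with \<open>f\<close> fixed.\<close>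

lemma Ck_inverse:
  assumes "\<And>x. f x > 0" "\<And>k. Ck k f"
  shows "Ck k (\<lambda>x. inverse (f x))"
proof (induction k)
  case 0
  then show ?case 
    using assms(1) assms(2)[of 0] continuous_on_inverse[of UNIV f] by (simp add: less_imp_neq[symmetric])
next
  case (Suc k)
  have nz: "f x \<noteq> 0" for x using assms(1)[of x] by simp
  have d: "f differentiable at x" for x using assms(2)[of "Suc 0"] by simp
  have *: "((\<lambda>t. inverse t) has_real_derivative - (inverse (f x) * inverse (f x))) (at (f x))" for x
    by (auto intro!: derivative_eq_intros nz)
  have "partial_deriv i (\<lambda>x. inverse (f x)) 
      = (\<lambda>x. -1 * (inverse (f x) * inverse (f x) * partial_deriv i f x))" for i
    by (rule ext, subst partial_deriv_chain[OF d *]) simp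
  moreover have "(\<lambda>x. inverse (f x)) differentiable at x" for x
    using d nz by (auto intro!: derivative_intros)
  moreover have "Ck k (\<lambda>x. -1 * (inverse (f x) * inverse (f x) * partial_deriv i f x))" for i
    using assms(2)[of "Suc k"] by (intro Ck_cmult Ck_mult Suc) simp
  ultimately show ?case unfolding Ck.simps by metis
qed

lemma Ck_nth [simp]: "Ck k (\<lambda>x::real^'n. x $ i)"
proof (cases k)
  case (Suc m)
  have d: "((\<lambda>x::real^'n. x $ i) has_derivative (\<lambda>h. h $ i)) (at x)" for x
    by (rule bounded_linear.has_derivative[OF bounded_linear_vec_nth has_derivative_ident])
  have "partial_deriv j (\<lambda>x::real^'n. x $ i) = (\<lambda>x. axis j 1 $ i)" for j
    by (rule ext, rule partial_deriv_eq[OF d])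
  then show ?thesis using Suc d by (auto simp: differentiable_def)
qed (simp add: continuous_on_component)

section \<open>Smooth cutoff functions\<close>

text \<open>With \<open>s = 1 / t\<close>, the derivative of \<open>p(s) exp(-s)\<close> in
  \<open>t\<close> is \<open>s^2 (p(s) - p'(s)) exp(-s)\<close>; \<open>[:0, 0, 1:]\<close> is the
  factor \<open>s^2\<close>.\<close>

primrec bump_poly :: "nat \<Rightarrow> real poly" where
  "bump_poly 0 = 1"
| "bump_poly (Suc m) = [:0, 0, 1:] * (bump_poly m - pderiv (bump_poly m))"

text \<open>The \<open>m\<close>-th derivative of the smooth function equal to
  \<open>exp (- (1 / t))\<close> for positive \<open>t\<close> and to zero otherwise.\<close>

definition exp_bump :: "nat \<Rightarrow> real \<Rightarrow> real"
  where "exp_bump m t = (if t > 0 then poly (bump_poly m) (1 / t) * exp (- (1 / t)) else 0)"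

text \<open>Arbitrary powers of \<open>s\<close> are included to let the induction on \<open>p\<close> go through.\<close>

lemma poly_times_exp_neg_tendsto_0:
  "((\<lambda>s. s ^ k * (poly p s * exp (- s))) \<longlongrightarrow> 0) (at_top :: real filter)"
proof (induction p arbitrary: k)
  case (pCons a p)
  have "((\<lambda>s. a * (s ^ k / exp s) + s ^ Suc k * (poly p s * exp (- s))) \<longlongrightarrow> a * 0 + 0) (at_top :: real filter)"
    by (intro tendsto_intros tendsto_power_div_exp_0 pCons.IH)
  then show ?case
    by (simp add: exp_minus field_simps)
qed simp

text \<open>Only \<open>t = 0\<close> is delicate: the right difference quotient there is
  \<open>s p(s) exp(-s)\<close> with \<open>s = 1 / h\<close> tending to infinity, and the
  exponential beats every polynomial.\<close>

lemma exp_bump_derivative: "(exp_bump m has_real_derivative exp_bump (Suc m) t) (at t)"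
proof -
  consider "t > 0" | "t < 0" | "t = 0" by linarith
  then show ?thesis
  proof cases
    case 1
    have "((\<lambda>t. poly (bump_poly m) (1 / t) * exp (- (1 / t))) has_real_derivative exp_bump (Suc m) t) (at t)"
      using 1 by (auto intro!: derivative_eq_intros simp: exp_bump_def field_simps power2_eq_square)
    moreover have "open {0::real<..}" "t \<in> {0<..}" using 1 by auto
    ultimately show ?thesis
      by (rule has_field_derivative_transform_within_open) (auto simp: exp_bump_def)
  next
    case 2
    have "((\<lambda>t. 0) has_real_derivative exp_bump (Suc m) t) (at t)"
      using 2 by (auto simp: exp_bump_def)
    moreover have "open {..<0::real}" "t \<in> {..<0}" using 2 by auto
    ultimately show ?thesis
      by (rule has_field_derivative_transform_within_open) (auto simp: exp_bump_def)
  next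
    case 3
    have "((\<lambda>h. exp_bump m h / h) \<longlongrightarrow> 0) (at_left 0)"
      by (rule tendsto_eventually) (auto simp: exp_bump_def eventually_at_filter)
    moreover have "((\<lambda>h. exp_bump m h / h) \<longlongrightarrow> 0) (at_right 0)"
    proof -
      have "((\<lambda>h::real. (inverse h) ^ 1 * (poly (bump_poly m) (inverse h) * exp (- (inverse h)))) \<longlongrightarrow> 0) (at_right 0)"
        by (rule filterlim_compose[OF poly_times_exp_neg_tendsto_0 filterlim_inverse_at_top_right])
      then show ?thesis
        by (rule Lim_transform_eventually)
           (auto simp: exp_bump_def eventually_at_filter field_simps)
    qed
    ultimately have "((\<lambda>h. exp_bump m h / h) \<longlongrightarrow> 0) (at 0)"
      by (rule filterlim_split_at_real)
    then show ?thesis using 3 by (simp add: DERIV_def exp_bump_def)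
  qed
qed

lemma Ck_exp_bump: "(\<And>k. Ck k f) \<Longrightarrow> Ck k (\<lambda>x. exp_bump m (f x))"
  by (rule Ck_chain[where h = exp_bump]) (rule exp_bump_derivative)

text \<open>The quotient \<open>e(f) / (e(f) + e(1 - f))\<close> with \<open>e = exp_bump 0\<close>
  works; its denominator never vanishes because \<open>f\<close> and \<open>1 - f\<close> cannot
  both be nonpositive.\<close>

lemma smooth_step_exists:
  fixes f :: "real ^ 'n \<Rightarrow> real"
  assumes "\<And>k. Ck k f"
  obtains b :: "real ^ 'n \<Rightarrow> real"
  where "\<And>k. Ck k b" "\<And>x. 0 \<le> b x" "\<And>x. b x \<le> 1"
    "\<And>x. f x \<ge> 1 \<Longrightarrow> b x = 1" "\<And>x. f x \<le> 0 \<Longrightarrow> b x = 0"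
proof
  let ?e = "exp_bump 0"
  let ?d = "\<lambda>x. ?e (f x) + ?e (1 - f x)"
  let ?b = "\<lambda>x. ?e (f x) * inverse (?d x)"
  have e: "?e t \<ge> 0" "t > 0 \<Longrightarrow> ?e t > 0" "t \<le> 0 \<Longrightarrow> ?e t = 0" for t
    by (auto simp: exp_bump_def)
  have pos: "?d x > 0" for x
    using e(1,2)[of "f x"] e(1,2)[of "1 - f x"] by (cases "f x > 0") (auto simp: add_pos_nonneg add_nonneg_pos)
  have "Ck k ?d" for k
    using assms by (intro Ck_add Ck_exp_bump Ck_diff) auto
  then show "Ck k ?b" for k
    using assms pos by (intro Ck_mult Ck_exp_bump Ck_inverse) auto
  show "0 \<le> ?b x" for x using e(1)[of "f x"] pos[of x] by simp
  show "?b x \<le> 1" for x using e(1)[of "1 - f x"] pos[of x] by (simp add: field_simps)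
  show "?b x = 1" if "f x \<ge> 1" for x using that e(3)[of "1 - f x"] pos[of x] by (simp add: field_simps)
  show "?b x = 0" if "f x \<le> 0" for x using that e(3)[of "f x"] by simp
qed

lemma smooth_ball_cutoff_exists:
  fixes c :: "real ^ 'n"
  assumes "r > 0"
  obtains b :: "real ^ 'n \<Rightarrow> real"
  where "\<And>k. Ck k b" "\<And>x. 0 \<le> b x" "\<And>x. b x \<le> 1"
    "\<And>x. x \<in> ball c (r / 2) \<Longrightarrow> b x = 1" "\<And>x. x \<notin> ball c r \<Longrightarrow> b x = 0"
proof -
  \<comment> \<open>On the half ball \<open>r^2 - |x - c|^2\<close> is at least
    \<open>3 r^2 / 4\<close>, which the leading factor raises to 1; outside the ball it is
    nonpositive. The squared distance is written as a polynomial in the coordinates to make its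
    smoothness immediate.\<close>
  let ?q = "\<lambda>x. 4 / (3 * r\<^sup>2) * (r\<^sup>2 - (\<Sum>i\<in>UNIV. (x $ i - c $ i) * (x $ i - c $ i)))"
  have "Ck k ?q" for k
    by (intro Ck_cmult Ck_diff Ck_sum Ck_mult) auto
  then obtain b :: "real ^ 'n \<Rightarrow> real" where b: "\<And>k. Ck k b" "\<And>x. 0 \<le> b x" "\<And>x. b x \<le> 1"
    "\<And>x. ?q x \<ge> 1 \<Longrightarrow> b x = 1" "\<And>x. ?q x \<le> 0 \<Longrightarrow> b x = 0"
    by (rule smooth_step_exists) blast
  have q: "?q x = 4 / (3 * r\<^sup>2) * (r\<^sup>2 - (dist c x)\<^sup>2)" for x
    by (simp add: dist_norm norm_minus_commute[of c] power2_norm_eq_inner inner_vec_def)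
  show thesis
  proof
    fix x assume "x \<in> ball c (r / 2)"
    then have "(dist c x)\<^sup>2 \<le> (r / 2)\<^sup>2" by (intro power_mono) auto
    then show "b x = 1" using assms by (intro b(4), subst q) (simp add: field_simps)
  next
    fix x assume "x \<notin> ball c r"
    then have "r\<^sup>2 \<le> (dist c x)\<^sup>2" using assms by (intro power_mono) auto
    then show "b x = 0" using assms by (intro b(5), subst q) (simp add: field_simps)
  qed (use b in auto)
qed

lemma test_functionsI:
  "(\<And>k. Ck k \<phi>) \<Longrightarrow> compact K \<Longrightarrow> K \<subseteq> S \<Longrightarrow> (\<And>x. x \<notin> K \<Longrightarrow> \<phi> x = 0) \<Longrightarrow> \<phi> \<in> test_functions S"
  unfolding test_functions_def by blast

lemma test_functionsE:
  assumes "\<phi> \<in> test_functions S"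
  obtains K where "\<And>k. Ck k \<phi>" "compact K" "K \<subseteq> S" "\<And>x. x \<notin> K \<Longrightarrow> \<phi> x = 0"
  using assms unfolding test_functions_def by blast

lemma test_functions_cutoff_exists:
  fixes K U :: "(real ^ 'n) set"
  assumes "compact K" "open U" "K \<subseteq> U"
  obtains \<eta> where "\<eta> \<in> test_functions U" "\<And>x. 0 \<le> \<eta> x" "\<And>x. \<eta> x \<le> 1" "\<And>x. x \<in> K \<Longrightarrow> \<eta> x = 1"
proof -
  have "\<exists>r>0. cball c r \<subseteq> U" if "c \<in> K" for c
    using that assms open_contains_cball by blast
  then obtain r where r: "\<And>c. c \<in> K \<Longrightarrow> r c > 0 \<and> cball c (r c) \<subseteq> U" by metis
  obtain C where C: "C \<subseteq> K" "finite C" "K \<subseteq> (\<Union>c\<in>C. ball c (r c / 2))"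
  proof (rule compactE_image[OF assms(1), of K "\<lambda>c. ball c (r c / 2)"])
    show "K \<subseteq> (\<Union>c\<in>K. ball c (r c / 2))" using r by force
  qed auto
  have "\<exists>b. (\<forall>k. Ck k b) \<and> (\<forall>x. 0 \<le> b x \<and> b x \<le> 1) \<and> (\<forall>x \<in> ball c (r c / 2). b x = 1) \<and>
      (\<forall>x. x \<notin> ball c (r c) \<longrightarrow> b x = 0)" if "c \<in> K" for c
    using smooth_ball_cutoff_exists[of "r c" c] r[OF that] by metis
  then obtain b where b: "\<And>c k. c \<in> K \<Longrightarrow> Ck k (b c)" "\<And>c x. c \<in> K \<Longrightarrow> 0 \<le> b c x \<and> b c x \<le> 1"
    "\<And>c x. c \<in> K \<Longrightarrow> x \<in> ball c (r c / 2) \<Longrightarrow> b c x = 1"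
    "\<And>c x. c \<in> K \<Longrightarrow> x \<notin> ball c (r c) \<Longrightarrow> b c x = 0" by metis
  \<comment> \<open>A single factor \<open>1 - b c x = 0\<close> makes this 1, and if all
    \<open>b c x\<close> vanish it is 0. Unlike the sum of the \<open>b c\<close>, it never exceeds
    1.\<close>
  let ?\<eta> = "\<lambda>x. 1 - (\<Prod>c\<in>C. 1 - b c x)"
  let ?K = "\<Union>c\<in>C. cball c (r c)"
  have 01: "0 \<le> (\<Prod>c\<in>C. 1 - b c x)" "(\<Prod>c\<in>C. 1 - b c x) \<le> 1" for x
    using b(2) C(1) by (auto intro!: prod_nonneg prod_le_1)
  show thesis
  proof
    show "?\<eta> \<in> test_functions U"
    proof (rule test_functionsI)
      show "Ck k ?\<eta>" for k using b(1) C(1) by (intro Ck_diff Ck_prod) auto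
      show "compact ?K" using C(2) by auto
      show "?K \<subseteq> U" using r C(1) by blast
      show "?\<eta> x = 0" if "x \<notin> ?K" for x
      proof -
        have "1 - b c x = 1" if "c \<in> C" for c
          using b(4)[of c x] \<open>x \<notin> ?K\<close> that C(1) by (force simp: subset_eq)
        then show ?thesis by simp
      qed
    qed
    show "0 \<le> ?\<eta> x" "?\<eta> x \<le> 1" for x using 01[of x] by auto
    show "?\<eta> x = 1" if "x \<in> K" for x
    proof -
      obtain c where "c \<in> C" "x \<in> ball c (r c / 2)" using C(3) \<open>x \<in> K\<close> by blast
      then have "\<exists>c\<in>C. 1 - b c x = 0" using b(3) C(1) by force
      then show ?thesis using C(2) by (simp add: prod_zero)
    qed
  qed
qed

section \<open>Square integrable functions\<close>

lemma L2_measurable: "f \<in> L2 M \<Longrightarrow> f \<in> borel_measurable M"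
  by (simp add: L2_def)

lemma L2_square_integrable: "f \<in> L2 M \<Longrightarrow> integrable M (\<lambda>x. (f x)\<^sup>2)"
  by (simp add: L2_def)

lemma L2_mult_integrable:
  assumes "f \<in> L2 M" "g \<in> L2 M"
  shows "integrable M (\<lambda>x. f x * g x)"
proof (rule Bochner_Integration.integrable_bound)
  show "integrable M (\<lambda>x. (f x)\<^sup>2 + (g x)\<^sup>2)"
    using assms by (auto simp: L2_def)
  show "(\<lambda>x. f x * g x) \<in> borel_measurable M"
    using assms by (auto simp: L2_def)
  have "\<bar>a * b\<bar> \<le> a\<^sup>2 + b\<^sup>2" for a b :: real
    using sum_squares_bound[of "\<bar>a\<bar>" "\<bar>b\<bar>"] zero_le_power2[of a] zero_le_power2[of b]
    by (simp only: abs_mult power2_abs)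
  then show "AE x in M. norm (f x * g x) \<le> norm ((f x)\<^sup>2 + (g x)\<^sup>2)"
    by simp
qed

lemma L2_add: "f \<in> L2 M \<Longrightarrow> g \<in> L2 M \<Longrightarrow> (\<lambda>x. f x + g x) \<in> L2 M"
  using L2_mult_integrable[of f M g] by (auto simp: L2_def power2_sum mult.assoc)

lemma L2_cmult: "f \<in> L2 M \<Longrightarrow> (\<lambda>x. c * f x) \<in> L2 M"
  by (auto simp: L2_def power_mult_distrib)

lemma L2_diff: "f \<in> L2 M \<Longrightarrow> g \<in> L2 M \<Longrightarrow> (\<lambda>x. f x - g x) \<in> L2 M"
  using L2_add[OF _ L2_cmult[of g M "-1"], of f] by simp

lemma L2_integrable: "finite_measure M \<Longrightarrow> f \<in> L2 M \<Longrightarrow> integrable M f"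
  using L2_mult_integrable[of f M "\<lambda>x. 1"] finite_measure.integrable_const[of M]
  by (auto simp: L2_def)

definition l2norm :: "'a measure \<Rightarrow> ('a \<Rightarrow> real) \<Rightarrow> real"
  where "l2norm M f = sqrt (\<integral>x. (f x)\<^sup>2 \<partial>M)"

lemma l2norm_nonneg [simp]: "0 \<le> l2norm M f"
  by (simp add: l2norm_def)

lemma l2norm_square: "(l2norm M f)\<^sup>2 = (\<integral>x. (f x)\<^sup>2 \<partial>M)"
  by (simp add: l2norm_def)

lemma L2_cauchy_schwarz:
  assumes "f \<in> L2 M" "g \<in> L2 M"
  shows "\<bar>\<integral>x. f x * g x \<partial>M\<bar> \<le> l2norm M f * l2norm M g"
proof -
  let ?a = "\<integral>x. (f x)\<^sup>2 \<partial>M" and ?b = "\<integral>x. f x * g x \<partial>M" and ?c = "\<integral>x. (g x)\<^sup>2 \<partial>M"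
  have i: "integrable M (\<lambda>x. (f x)\<^sup>2)" "integrable M (\<lambda>x. f x * g x)" "integrable M (\<lambda>x. (g x)\<^sup>2)"
    using assms L2_mult_integrable by (auto simp: L2_def)
  have q: "0 \<le> s\<^sup>2 * ?a + 2 * s * t * ?b + t\<^sup>2 * ?c" for s t
  proof -
    have "0 \<le> (\<integral>x. (s * f x + t * g x)\<^sup>2 \<partial>M)" by simp
    also have "\<dots> = (\<integral>x. s\<^sup>2 * (f x)\<^sup>2 + 2 * s * t * (f x * g x) + t\<^sup>2 * (g x)\<^sup>2 \<partial>M)"
      by (simp add: power2_eq_square algebra_simps)
    also have "\<dots> = s\<^sup>2 * ?a + 2 * s * t * ?b + t\<^sup>2 * ?c"
      using i by simp
    finally show ?thesis .
  qed
  have "?b\<^sup>2 \<le> ?a * ?c"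
  proof (cases "?c = 0")
    case True
    have "?b = 0"
    proof (rule ccontr)
      assume "?b \<noteq> 0"
      \<comment> \<open>For \<open>s = 1\<close> the form is affine in \<open>t\<close>, and this
        \<open>t\<close> gives it the value \<open>-1\<close>.\<close>
      then show False using q[of 1 "- (?a + 1) / (2 * ?b)"] True by (simp add: field_simps)
    qed
    then show ?thesis using True by simp
  next
    case False
    then have "?c > 0" by (simp add: less_le)
    \<comment> \<open>The form is evaluated in its minimising direction \<open>s = c\<close>,
      \<open>t = - b\<close>, where the discriminant appears with the factor
      \<open>c\<close>.\<close>
    moreover have "0 \<le> ?c * (?a * ?c - ?b\<^sup>2)"
      using q[of ?c "- ?b"] by (simp add: power2_eq_square algebra_simps)
    ultimately show ?thesis by (simp add: zero_le_mult_iff)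
  qed
  then have "\<bar>?b\<bar> \<le> sqrt (?a * ?c)" using real_le_rsqrt by fastforce
  then show ?thesis by (simp add: l2norm_def real_sqrt_mult)
qed

lemma l2norm_triangle:
  assumes "f \<in> L2 M" "g \<in> L2 M"
  shows "l2norm M (\<lambda>x. f x + g x) \<le> l2norm M f + l2norm M g"
proof -
  have "(l2norm M (\<lambda>x. f x + g x))\<^sup>2 = (l2norm M f)\<^sup>2 + (l2norm M g)\<^sup>2 + 2 * (\<integral>x. f x * g x \<partial>M)"
    using assms L2_mult_integrable[OF assms]
    by (simp add: l2norm_square power2_sum L2_def mult.assoc)
  also have "\<dots> \<le> (l2norm M f + l2norm M g)\<^sup>2"
    using L2_cauchy_schwarz[OF assms] by (simp add: power2_sum)
  finally show ?thesis by (rule power2_le_imp_le) simp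
qed

lemma L2_tendsto_inner:
  assumes "g \<in> L2 M" "\<And>k. f k \<in> L2 M" "h \<in> L2 M" "(\<lambda>k. l2norm M (\<lambda>x. f k x - h x)) \<longlonglongrightarrow> 0"
  shows "(\<lambda>k. \<integral>x. g x * f k x \<partial>M) \<longlonglongrightarrow> (\<integral>x. g x * h x \<partial>M)"
proof (rule LIM_zero_cancel, rule Lim_null_comparison)
  have "(\<integral>x. g x * f k x \<partial>M) - (\<integral>x. g x * h x \<partial>M) = (\<integral>x. g x * (f k x - h x) \<partial>M)" for k
    using L2_mult_integrable[OF assms(1,2)] L2_mult_integrable[OF assms(1,3)]
    by (simp add: right_diff_distrib)
  then show "\<forall>\<^sub>F k in sequentially. norm ((\<integral>x. g x * f k x \<partial>M) - (\<integral>x. g x * h x \<partial>M)) 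
     \<le> l2norm M g * l2norm M (\<lambda>x. f k x - h x)"
    using L2_cauchy_schwarz[OF assms(1) L2_diff[OF assms(2,3)]] by simp
  show "(\<lambda>k. l2norm M g * l2norm M (\<lambda>x. f k x - h x)) \<longlonglongrightarrow> 0"
    using tendsto_mult_left_zero[OF assms(4)] tendsto_mult_right_zero[OF assms(4)] by simp
qed

lemma L2_tendsto_norm:
  assumes "\<And>k. f k \<in> L2 M" "h \<in> L2 M" "(\<lambda>k. l2norm M (\<lambda>x. f k x - h x)) \<longlonglongrightarrow> 0"
  shows "(\<lambda>k. l2norm M (f k)) \<longlonglongrightarrow> l2norm M h"
proof (rule LIM_zero_cancel, rule Lim_null_comparison[OF _ assms(3)])
  have "l2norm M (f k) \<le> l2norm M (\<lambda>x. f k x - h x) + l2norm M h" for k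
    using l2norm_triangle[OF L2_diff[OF assms(1,2)] assms(2)] by simp
  moreover have "l2norm M h \<le> l2norm M (\<lambda>x. f k x - h x) + l2norm M (f k)" for k
    using l2norm_triangle[OF L2_diff[OF assms(2,1)] assms(1), of k k]
    by (simp add: l2norm_def power2_commute)
  ultimately show "\<forall>\<^sub>F k in sequentially. norm (l2norm M (f k) - l2norm M h) \<le> l2norm M (\<lambda>x. f k x - h x)"
    by (simp add: abs_le_iff algebra_simps)
qed

lemma l2norm_cong_AE:
  assumes "AE x in M. f x = g x" "f \<in> borel_measurable M" "g \<in> borel_measurable M"
  shows "l2norm M f = l2norm M g"
proof -
  have "(\<integral>x. (f x)\<^sup>2 \<partial>M) = (\<integral>x. (g x)\<^sup>2 \<partial>M)"
    using assms by (intro integral_cong_AE) auto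
  then show ?thesis by (simp add: l2norm_def)
qed

lemma integral_inner_eq_sum:
  fixes u v :: "real ^ 'n \<Rightarrow> real ^ 'm"
  assumes "\<And>j. (\<lambda>x. u x $ j) \<in> L2 M" "\<And>j. (\<lambda>x. v x $ j) \<in> L2 M"
  shows "(\<integral>x. u x \<bullet> v x \<partial>M) = (\<Sum>j\<in>UNIV. \<integral>x. u x $ j * v x $ j \<partial>M)"
  unfolding inner_vec_def
  by (simp add: Bochner_Integration.integral_sum L2_mult_integrable assms)

section \<open>Test functions and integration by parts\<close>

lemma test_functions_Ck: "\<phi> \<in> test_functions S \<Longrightarrow> Ck k \<phi>"
  unfolding test_functions_def by blast

lemma test_functions_differentiable: "\<phi> \<in> test_functions S \<Longrightarrow> \<phi> differentiable at x"
  using test_functions_Ck[of \<phi> S "Suc 0"] by simp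

lemma test_functions_continuous: "\<phi> \<in> test_functions S \<Longrightarrow> continuous_on UNIV \<phi>"
  using Ck_imp_continuous test_functions_Ck by blast

lemma test_functions_borel [measurable_dest]: "\<phi> \<in> test_functions S \<Longrightarrow> \<phi> \<in> borel_measurable borel"
  using test_functions_continuous borel_measurable_continuous_onI by blast

lemma test_functions_vanish: "\<phi> \<in> test_functions S \<Longrightarrow> x \<notin> S \<Longrightarrow> \<phi> x = 0"
  unfolding test_functions_def by blast

lemma test_functions_mono: "\<phi> \<in> test_functions S \<Longrightarrow> S \<subseteq> S' \<Longrightarrow> \<phi> \<in> test_functions S'"
  unfolding test_functions_def by blast

lemma test_functions_zero [simp]: "(\<lambda>x. 0) \<in> test_functions S"
  by (rule test_functionsI[where K = "{}"]) auto

lemma test_functions_add: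
  assumes "\<phi> \<in> test_functions S" "\<psi> \<in> test_functions S"
  shows "(\<lambda>x. \<phi> x + \<psi> x) \<in> test_functions S"
proof -
  obtain K L where "compact K" "K \<subseteq> S" "\<And>x. x \<notin> K \<Longrightarrow> \<phi> x = 0"
    "compact L" "L \<subseteq> S" "\<And>x. x \<notin> L \<Longrightarrow> \<psi> x = 0"
    using assms by (metis test_functionsE)
  then show ?thesis
    by (intro test_functionsI[where K = "K \<union> L"] Ck_add assms[THEN test_functions_Ck]) auto
qed

lemma test_functions_mult:
  assumes "\<phi> \<in> test_functions S" "\<And>k. Ck k f"
  shows "(\<lambda>x. f x * \<phi> x) \<in> test_functions S"
proof -
  obtain K where "compact K" "K \<subseteq> S" "\<And>x. x \<notin> K \<Longrightarrow> \<phi> x = 0"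
    using assms(1) by (metis test_functionsE)
  then show ?thesis
    by (intro test_functionsI[where K = K] Ck_mult assms(2) test_functions_Ck[OF assms(1)]) simp_all
qed

lemma test_functions_diff:
  assumes "\<phi> \<in> test_functions S" "\<psi> \<in> test_functions S"
  shows "(\<lambda>x. \<phi> x - \<psi> x) \<in> test_functions S"
  using test_functions_add[OF assms(1) test_functions_mult[OF assms(2), of "\<lambda>x. -1"]] by simp

lemma partial_deriv_zero_outside:
  assumes "closed K" "\<And>x. x \<notin> K \<Longrightarrow> f x = 0" "x \<notin> K"
  shows "partial_deriv i f x = 0"
proof -
  have "(f has_derivative (\<lambda>h. 0)) (at x)"
    by (rule has_derivative_transform_within_open[OF has_derivative_const[of 0], of "- K"]) (use assms in auto)
  then show ?thesis using partial_deriv_eq by blast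
qed

lemma test_functions_partial_deriv:
  assumes "\<phi> \<in> test_functions S"
  shows "partial_deriv i \<phi> \<in> test_functions S"
proof -
  obtain K where K: "compact K" "K \<subseteq> S" "\<And>x. x \<notin> K \<Longrightarrow> \<phi> x = 0"
    using assms by (metis test_functionsE)
  have "Ck k (partial_deriv i \<phi>)" for k using test_functions_Ck[OF assms, of "Suc k"] by simp
  then show ?thesis
    using K partial_deriv_zero_outside[OF compact_imp_closed[OF K(1)] K(3)] by (intro test_functionsI)
qed

lemma test_functions_integrable:
  assumes "\<phi> \<in> test_functions S"
  shows "integrable lborel \<phi>"
proof -
  obtain K where K: "compact K" "\<And>x. x \<notin> K \<Longrightarrow> \<phi> x = 0"
    using assms by (metis test_functionsE)
  have "(\<lambda>x. indicator K x *\<^sub>R \<phi> x) = \<phi>" using K(2) by (intro ext) (auto simp: indicator_def)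
  then show ?thesis
    using borel_integrable_compact[OF K(1) continuous_on_subset[OF test_functions_continuous[OF assms] subset_UNIV]]
    by simp
qed

lemma test_functions_bounded:
  assumes "\<phi> \<in> test_functions S"
  obtains B where "B > 0" "\<And>x. \<bar>\<phi> x\<bar> \<le> B"
proof -
  obtain K where K: "compact K" "\<And>x. x \<notin> K \<Longrightarrow> \<phi> x = 0"
    using assms by (metis test_functionsE)
  have "compact (\<phi> ` K)"
    using K(1) test_functions_continuous[OF assms] compact_continuous_image continuous_on_subset by blast
  then obtain B where B: "B > 0" "\<And>y. y \<in> \<phi> ` K \<Longrightarrow> norm y \<le> B"
    using compact_imp_bounded bounded_pos by metis
  then have "\<bar>\<phi> x\<bar> \<le> B" for x
    using K(2)[of x] by (cases "x \<in> K") auto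
  with B(1) show thesis by (rule that)
qed

lemma test_functions_L2: "\<phi> \<in> test_functions S \<Longrightarrow> \<phi> \<in> L2 lborel"
  using test_functions_integrable[OF test_functions_mult[of \<phi> S \<phi>]]
  by (auto simp: L2_def power2_eq_square test_functions_borel test_functions_Ck)

lemma integral_translate_lborel:
  fixes f :: "real ^ 'n \<Rightarrow> real"
  assumes "f \<in> borel_measurable borel"
  shows "(\<integral>x. f (x + v) \<partial>lborel) = (\<integral>x. f x \<partial>lborel)"
proof -
  have "(\<integral>x. f x \<partial>lborel) = (\<integral>x. f x \<partial>distr lborel borel ((+) v))"
    by (simp add: lborel_distr_plus)
  also have "\<dots> = (\<integral>x. f (x + v) \<partial>lborel)"
    using assms by (subst integral_distr) (auto simp: add.commute)
  finally show ?thesis by simp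
qed

text \<open>The difference quotients have integral zero by translation invariance and converge to
  the partial derivative. The mean value theorem bounds them by a bound \<open>B\<close> for that
  derivative, and since the steps are at most 1 they vanish outside a ball of radius
  \<open>R + 1\<close>; this gives the dominating function.\<close>

lemma integral_partial_deriv_eq_0:
  fixes \<phi> :: "real ^ 'n \<Rightarrow> real"
  assumes "\<phi> \<in> test_functions S"
  shows "(\<integral>x. partial_deriv i \<phi> x \<partial>lborel) = 0"
proof -
  let ?e = "axis i 1 :: real ^ 'n"
  let ?p = "partial_deriv i \<phi>"
  let ?h = "\<lambda>n. inverse (real (Suc n))"
  let ?f = "\<lambda>n x. (\<phi> (x + ?h n *\<^sub>R ?e) - \<phi> x) / ?h n"
  have p: "?p \<in> test_functions S" by (rule test_functions_partial_deriv[OF assms])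
  obtain K where K: "compact K" "\<And>x. x \<notin> K \<Longrightarrow> \<phi> x = 0"
    using assms by (metis test_functionsE)
  obtain R where R: "R > 0" "\<And>x. x \<in> K \<Longrightarrow> norm x \<le> R"
    using compact_imp_bounded[OF K(1)] bounded_pos by metis
  obtain B where B: "B > 0" "\<And>x. \<bar>?p x\<bar> \<le> B" using test_functions_bounded[OF p] by metis
  have deriv: "((\<lambda>t. \<phi> (x + t *\<^sub>R ?e)) has_real_derivative ?p (x + t *\<^sub>R ?e)) (at t)" for x t
  proof -
    have "((\<lambda>t. x + t *\<^sub>R ?e) has_derivative (\<lambda>s. s *\<^sub>R ?e)) (at t)"
      by (auto intro!: derivative_eq_intros)
    from has_derivative_compose[OF this differentiable_has_derivative[OF test_functions_differentiable[OF assms]]]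
    have "((\<lambda>t. \<phi> (x + t *\<^sub>R ?e)) has_derivative
        (\<lambda>s. frechet_derivative \<phi> (at (x + t *\<^sub>R ?e)) (s *\<^sub>R ?e))) (at t)" .
    moreover have "frechet_derivative \<phi> (at y) (s *\<^sub>R ?e) = ?p y * s" for s y
      using linear_cmul[OF linear_frechet_derivative[OF test_functions_differentiable[OF assms]]]
      by (simp add: partial_deriv_def mult.commute)
    ultimately show ?thesis by (simp add: has_field_derivative_def)
  qed
  have 0: "(\<integral>x. ?f n x \<partial>lborel) = 0" for n
  proof -
    have "integrable lborel (\<lambda>x. \<phi> (x + ?h n *\<^sub>R ?e))"
    proof -
      have "integrable (distr lborel borel ((+) (?h n *\<^sub>R ?e))) \<phi>"
        using test_functions_integrable[OF assms] by (simp add: lborel_distr_plus)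
      then show ?thesis
        using test_functions_borel[OF assms] by (subst (asm) integrable_distr_eq) (auto simp: add.commute)
    qed
    then show ?thesis
      using test_functions_integrable[OF assms] integral_translate_lborel[OF test_functions_borel[OF assms]]
      by simp
  qed
  have "(\<lambda>n. \<integral>x. ?f n x \<partial>lborel) \<longlonglongrightarrow> (\<integral>x. ?p x \<partial>lborel)"
  proof (rule integral_dominated_convergence[where w = "\<lambda>x. B * indicator (cball 0 (R + 1)) x"])
    show "?p \<in> borel_measurable lborel" using test_functions_borel[OF p] by simp
    show "?f n \<in> borel_measurable lborel" for n using test_functions_borel[OF assms] by measurable
    show "integrable lborel (\<lambda>x::real^'n. B * indicator (cball 0 (R + 1)) x)"
      using emeasure_lborel_cball_finite[of "0::real^'n" "R + 1"] by simp
    show "AE x in lborel. (\<lambda>n. ?f n x) \<longlonglongrightarrow> ?p x"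
    proof (intro AE_I2)
      fix x
      have "((\<lambda>h. (\<phi> (x + h *\<^sub>R ?e) - \<phi> x) / h) \<longlongrightarrow> ?p x) (at 0)"
        using deriv[of x 0] by (simp add: DERIV_def)
      moreover have "filterlim ?h (at 0) sequentially"
        using LIMSEQ_inverse_real_of_nat by (auto simp: filterlim_at simp del: of_nat_Suc)
      ultimately show "(\<lambda>n. ?f n x) \<longlonglongrightarrow> ?p x" by (rule filterlim_compose)
    qed
    show "AE x in lborel. norm (?f n x) \<le> B * indicator (cball 0 (R + 1)) x" for n
    proof (intro AE_I2)
      fix x
      have h: "?h n > 0" "?h n \<le> 1" by (auto simp: field_simps)
      obtain z where "\<phi> (x + ?h n *\<^sub>R ?e) - \<phi> (x + 0 *\<^sub>R ?e) = (?h n - 0) * ?p (x + z *\<^sub>R ?e)"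
        using MVT2[OF h(1), of "\<lambda>t. \<phi> (x + t *\<^sub>R ?e)" "\<lambda>t. ?p (x + t *\<^sub>R ?e)"] deriv by blast
      then have "?f n x = ?p (x + z *\<^sub>R ?e)" using h by (simp add: field_simps)
      then have 1: "norm (?f n x) \<le> B" using B(2) by simp
      show "norm (?f n x) \<le> B * indicator (cball 0 (R + 1)) x"
      proof (cases "norm x \<le> R + 1")
        case True
        then show ?thesis using 1 by (simp add: indicator_def)
      next
        case False
        have "norm x \<le> norm (x + ?h n *\<^sub>R ?e) + ?h n"
          using norm_triangle_ineq4[of "x + ?h n *\<^sub>R ?e" "?h n *\<^sub>R ?e"] h by (simp add: norm_axis_1)
        then have "x \<notin> K" "x + ?h n *\<^sub>R ?e \<notin> K" using False R(2)[of x] R(2)[of "x + ?h n *\<^sub>R ?e"] h by auto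
        then show ?thesis using K(2) by (simp add: B(1) less_imp_le)
      qed
    qed
  qed
  then show ?thesis unfolding 0 using LIMSEQ_unique tendsto_const by blast
qed

lemma integral_by_parts:
  assumes "\<phi> \<in> test_functions S" "\<And>k. Ck k f"
  shows "(\<integral>x. f x * partial_deriv i \<phi> x \<partial>lborel) = - (\<integral>x. partial_deriv i f x * \<phi> x \<partial>lborel)"
proof -
  have f': "Ck k (partial_deriv i f)" for k using assms(2)[of "Suc k"] by simp
  have d: "f differentiable at x" for x using assms(2)[of "Suc 0"] by simp
  have "0 = (\<integral>x. f x * partial_deriv i \<phi> x + partial_deriv i f x * \<phi> x \<partial>lborel)"
    using integral_partial_deriv_eq_0[OF test_functions_mult[OF assms], of i]
    by (simp add: partial_deriv_mult d test_functions_differentiable[OF assms(1)])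
  also have "\<dots> = (\<integral>x. f x * partial_deriv i \<phi> x \<partial>lborel) + (\<integral>x. partial_deriv i f x * \<phi> x \<partial>lborel)"
    using test_functions_integrable[OF test_functions_mult[OF test_functions_partial_deriv[OF assms(1)] assms(2)]]
      test_functions_integrable[OF test_functions_mult[OF assms(1) f']]
    by (intro Bochner_Integration.integral_add)
  finally show ?thesis by simp
qed

text \<open>The coordinate \<open>x $ i\<close> has derivative 1, so integration by parts turns the
  integral of \<open>u^2\<close> into that of \<open>- 2 (x $ i) u p\<close> with \<open>p\<close>
  the partial derivative of \<open>u\<close>. As \<open>|x $ i| \<le> R\<close> where
  \<open>u\<close> is nonzero, Young's inequality bounds the integrand by
  \<open>u^2 / 2 + 2 R^2 p^2\<close>; absorbing the first term doubles the second constant.\<close>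

lemma poincare_test_functions:
  fixes u :: "real ^ 'n \<Rightarrow> real"
  assumes "u \<in> test_functions S" "R > 0" "S \<subseteq> cball 0 R"
  shows "(\<integral>x. (u x)\<^sup>2 \<partial>lborel) \<le> 4 * R\<^sup>2 * (\<integral>x. (partial_deriv i u x)\<^sup>2 \<partial>lborel)"
proof -
  let ?p = "partial_deriv i u"
  have p: "?p \<in> test_functions S" by (rule test_functions_partial_deriv[OF assms(1)])
  have d: "u differentiable at x" for x by (rule test_functions_differentiable[OF assms(1)])
  have nth: "partial_deriv i (\<lambda>x. x $ i) x = 1" for x :: "real ^ 'n"
    by (subst partial_deriv_eq[OF bounded_linear.has_derivative[OF bounded_linear_vec_nth has_derivative_ident]]) simp
  have dn: "(\<lambda>x. x $ i) differentiable at x" for x :: "real ^ 'n"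
    using bounded_linear_imp_differentiable bounded_linear_vec_nth by blast
  have du: "(\<lambda>x. u x * u x) differentiable at x" for x using d by simp
  have u2: "(\<lambda>x. u x * u x) \<in> test_functions S"
    using assms(1) by (intro test_functions_mult test_functions_Ck)
  have "(\<integral>x. x $ i * partial_deriv i (\<lambda>x. u x * u x) x \<partial>lborel) = - (\<integral>x. 1 * (u x * u x) \<partial>lborel)"
    by (subst integral_by_parts[OF u2]) (simp_all add: nth)
  then have "(\<integral>x. (u x)\<^sup>2 \<partial>lborel) = - (\<integral>x. x $ i * (2 * u x * ?p x) \<partial>lborel)"
    by (simp add: partial_deriv_mult d power2_eq_square algebra_simps)
  also have "\<dots> = (\<integral>x. - (x $ i * (2 * u x * ?p x)) \<partial>lborel)" by simp
  also have "\<dots> \<le> (\<integral>x. (u x)\<^sup>2 / 2 + 2 * R\<^sup>2 * (?p x)\<^sup>2 \<partial>lborel)"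
  proof (rule integral_mono)
    have "(\<lambda>x. x $ i * (2 * u x * ?p x)) \<in> test_functions S"
      using test_functions_mult[OF p, of "\<lambda>x. x $ i * (2 * u x)"] test_functions_Ck[OF assms(1)]
      by (simp add: Ck_mult mult.assoc)
    then show "integrable lborel (\<lambda>x. - (x $ i * (2 * u x * ?p x)))"
      by (intro integrable_minus test_functions_integrable)
    show "integrable lborel (\<lambda>x. (u x)\<^sup>2 / 2 + 2 * R\<^sup>2 * (?p x)\<^sup>2)"
      using test_functions_L2[OF p] test_functions_L2[OF assms(1)] by (auto simp: L2_def)
    fix x
    show "- (x $ i * (2 * u x * ?p x)) \<le> (u x)\<^sup>2 / 2 + 2 * R\<^sup>2 * (?p x)\<^sup>2"
    proof (cases "x \<in> S")
      case True
      then have "\<bar>x $ i\<bar> \<le> R" using component_le_norm_cart[of x i] assms(3) by auto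
      then have "(x $ i)\<^sup>2 \<le> R\<^sup>2" using assms(2) by (simp add: abs_le_square_iff[symmetric])
      then have "2 * ((x $ i)\<^sup>2 * (?p x)\<^sup>2) \<le> 2 * (R\<^sup>2 * (?p x)\<^sup>2)" 
        by (intro mult_left_mono mult_right_mono) auto
      moreover have "0 \<le> (u x + 2 * (x $ i * ?p x))\<^sup>2" by simp
      ultimately show ?thesis by (simp add: power2_eq_square algebra_simps)
    next
      case False
      then show ?thesis using test_functions_vanish[OF assms(1)] by simp
    qed
  qed
  also have "\<dots> = (\<integral>x. (u x)\<^sup>2 \<partial>lborel) / 2 + 2 * R\<^sup>2 * (\<integral>x. (?p x)\<^sup>2 \<partial>lborel)"
    using test_functions_L2[OF p] test_functions_L2[OF assms(1)] by (simp add: L2_def)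
  finally show ?thesis by simp
qed

section \<open>Weak derivatives on a bounded open set\<close>

locale bounded_open_set =
  fixes \<Omega> :: "(real ^ 'n) set"
  assumes open_\<Omega>: "open \<Omega>" and bounded_\<Omega>: "bounded \<Omega>"
begin

lemma sets_\<Omega> [simp]: "\<Omega> \<in> sets lebesgue"
  using open_\<Omega> by (simp add: sets_completionI_sets)

lemma finite_measure_\<Omega>: "finite_measure (lebesgue_on \<Omega>)"
  by (rule finite_measureI)
     (use bounded_set_imp_lmeasurable[OF bounded_\<Omega> sets_\<Omega>] in
       \<open>simp add: emeasure_restrict_space space_restrict_space fmeasurable_def\<close>)

text \<open>Sobolev functions live on \<open>lebesgue_on \<Omega>\<close>, whereas translations and
  integration by parts are carried out over \<open>lborel\<close> on the whole space. These rules
  are the bridge for test functions and products with them.\<close>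

lemma
  fixes f :: "real ^ 'n \<Rightarrow> real"
  assumes "f \<in> borel_measurable borel" "\<And>x. x \<notin> \<Omega> \<Longrightarrow> f x = 0"
  shows integral_on_\<Omega>: "(\<integral>x. f x \<partial>lebesgue_on \<Omega>) = (\<integral>x. f x \<partial>lborel)"
    and integrable_on_\<Omega>: "integrable (lebesgue_on \<Omega>) f \<longleftrightarrow> integrable lborel f"
proof -
  have *: "(\<lambda>x. indicator \<Omega> x *\<^sub>R f x) = f"
    using assms(2) by (intro ext) (auto simp: indicator_def)
  show "(\<integral>x. f x \<partial>lebesgue_on \<Omega>) = (\<integral>x. f x \<partial>lborel)"
    by (subst integral_restrict_space) (simp_all only: *, simp_all add: integral_completion assms(1))
  show "integrable (lebesgue_on \<Omega>) f \<longleftrightarrow> integrable lborel f"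
    by (subst integrable_restrict_space) (simp_all only: *, simp_all add: integrable_completion assms(1))
qed

lemma borel_imp_measurable_on: "f \<in> borel_measurable borel \<Longrightarrow> f \<in> borel_measurable (lebesgue_on \<Omega>)"
  by (intro measurable_restrict_space1 measurable_completion) simp

lemma
  assumes "\<phi> \<in> test_functions \<Omega>"
  shows test_functions_L2_on: "\<phi> \<in> L2 (lebesgue_on \<Omega>)"
    and l2norm_test_function: "l2norm (lebesgue_on \<Omega>) \<phi> = l2norm lborel \<phi>"
proof -
  have *: "(\<lambda>x. (\<phi> x)\<^sup>2) \<in> borel_measurable borel" "\<And>x. x \<notin> \<Omega> \<Longrightarrow> (\<phi> x)\<^sup>2 = 0"
    using test_functions_borel[OF assms] test_functions_vanish[OF assms] by auto
  show "\<phi> \<in> L2 (lebesgue_on \<Omega>)"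
    using test_functions_L2[OF assms] integrable_on_\<Omega>[OF *]
      borel_imp_measurable_on[OF test_functions_borel[OF assms]] by (simp add: L2_def)
  show "l2norm (lebesgue_on \<Omega>) \<phi> = l2norm lborel \<phi>"
    by (simp add: l2norm_def integral_on_\<Omega>[OF *])
qed

section \<open>The fundamental lemma of the calculus of variations\<close>

lemma integral_compact_eq_0:
  assumes v: "integrable (lebesgue_on \<Omega>) v"
    and 0: "\<And>\<phi>. \<phi> \<in> test_functions \<Omega> \<Longrightarrow> (\<integral>x. v x * \<phi> x \<partial>lebesgue_on \<Omega>) = 0"
    and K: "compact K" "K \<subseteq> \<Omega>"
  shows "(\<integral>x. indicator K x * v x \<partial>lebesgue_on \<Omega>) = 0"
proof -
  \<comment> \<open>Cutoffs equal to 1 on \<open>K\<close> and supported in these shrinking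
    neighbourhoods converge pointwise to the indicator of \<open>K\<close>, with \<open>|v|\<close>
    dominating the integrands.\<close>
  let ?U = "\<lambda>m. \<Omega> \<inter> (\<Union>x\<in>K. ball x (inverse (real (Suc m))))"
  have "open (?U m)" "K \<subseteq> ?U m" for m using open_\<Omega> K by auto
  then have "\<exists>\<eta> \<in> test_functions (?U m). (\<forall>x. 0 \<le> \<eta> x \<and> \<eta> x \<le> 1) \<and> (\<forall>x\<in>K. \<eta> x = 1)" for m
    using test_functions_cutoff_exists[OF K(1)] by (metis (no_types, lifting))
  then obtain \<eta> where \<eta>: "\<And>m. \<eta> m \<in> test_functions (?U m)" "\<And>m x. 0 \<le> \<eta> m x \<and> \<eta> m x \<le> 1"
      "\<And>m x. x \<in> K \<Longrightarrow> \<eta> m x = 1" by metis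
  have \<eta>\<Omega>: "\<eta> m \<in> test_functions \<Omega>" for m using test_functions_mono[OF \<eta>(1)] by blast
  have [measurable]: "v \<in> borel_measurable (lebesgue_on \<Omega>)" using v by simp
  have [measurable]: "\<eta> m \<in> borel_measurable (lebesgue_on \<Omega>)" for m
    by (rule borel_imp_measurable_on[OF test_functions_borel[OF \<eta>\<Omega>]])
  have "(\<lambda>m. \<integral>x. v x * \<eta> m x \<partial>lebesgue_on \<Omega>) \<longlonglongrightarrow> (\<integral>x. indicator K x * v x \<partial>lebesgue_on \<Omega>)"
  proof (rule integral_dominated_convergence[where w = "\<lambda>x. \<bar>v x\<bar>"])
    have "indicator K \<in> borel_measurable (lebesgue_on \<Omega>)"
      using compact_imp_closed[OF K(1)] by (intro borel_imp_measurable_on) auto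
    then show "(\<lambda>x. indicator K x * v x) \<in> borel_measurable (lebesgue_on \<Omega>)"
      by (intro borel_measurable_times) auto
    show "integrable (lebesgue_on \<Omega>) (\<lambda>x. \<bar>v x\<bar>)" using v by simp
    show "AE x in lebesgue_on \<Omega>. norm (v x * \<eta> m x) \<le> \<bar>v x\<bar>" for m
      using \<eta>(2)[of m] by (intro AE_I2) (simp add: abs_mult mult_left_le)
    show "AE x in lebesgue_on \<Omega>. (\<lambda>m. v x * \<eta> m x) \<longlonglongrightarrow> indicator K x * v x"
    proof (intro AE_I2)
      fix x
      show "(\<lambda>m. v x * \<eta> m x) \<longlonglongrightarrow> indicator K x * v x"
      proof (cases "x \<in> K")
        case False
        have "open (- K)" using compact_imp_closed[OF K(1)] by auto
        then obtain e where e: "e > 0" "ball x e \<subseteq> - K" using False open_contains_ball by blast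
        have "\<forall>\<^sub>F m in sequentially. inverse (real (Suc m)) < e"
          using LIMSEQ_inverse_real_of_nat e(1) by (rule order_tendstoD)
        then have "\<forall>\<^sub>F m in sequentially. v x * \<eta> m x = 0"
        proof eventually_elim
          case (elim m)
          have "x \<notin> ?U m"
          proof
            assume "x \<in> ?U m"
            then obtain y where "y \<in> K" "dist y x < inverse (real (Suc m))" by auto
            then have "y \<in> ball x e" using elim by (simp add: dist_commute)
            then show False using \<open>y \<in> K\<close> e(2) by blast
          qed
          then show ?case using test_functions_vanish[OF \<eta>(1)] by simp
        qed
        then show ?thesis using False by (simp add: tendsto_eventually)
      qed (simp add: \<eta>(3))
    qed
  qed simp
  then show ?thesis unfolding 0[OF \<eta>\<Omega>] using LIMSEQ_unique tendsto_const by blast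
qed

text \<open>By inner regularity \<open>{v > 0}\<close> contains a compact \<open>T\<close> that
  misses less than measure \<open>e\<close> of it. The integral of \<open>v\<close> over
  \<open>T\<close> is zero although \<open>v\<close> is positive there, so \<open>T\<close> is null
  and \<open>{v > 0}\<close> has measure at most \<open>e\<close>.\<close>

lemma fundamental_lemma_nonpos:
  assumes v: "integrable (lebesgue_on \<Omega>) v"
    and 0: "\<And>\<phi>. \<phi> \<in> test_functions \<Omega> \<Longrightarrow> (\<integral>x. v x * \<phi> x \<partial>lebesgue_on \<Omega>) = 0"
  shows "AE x in lebesgue_on \<Omega>. v x \<le> 0"
proof -
  let ?M = "lebesgue_on \<Omega>" and ?P = "{x \<in> \<Omega>. v x > 0}"
  have [measurable]: "v \<in> borel_measurable ?M" using v by simp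
  have "{x \<in> space ?M. v x > 0} \<in> sets ?M" by measurable
  then have PM: "?P \<in> sets ?M" by simp
  then have P: "?P \<in> sets lebesgue" by (simp add: sets_restrict_space_iff)
  have "emeasure ?M ?P \<le> ennreal e" if "e > 0" for e
  proof -
    obtain T where T: "closed T" "T \<subseteq> ?P" "emeasure lebesgue (?P - T) < ennreal e" "?P - T \<in> lmeasurable"
      by (rule sets_lebesgue_inner_closed[OF P \<open>e > 0\<close>])
    have "compact T"
      unfolding compact_eq_bounded_closed
      using T(1,2) by (intro conjI bounded_subset[OF bounded_\<Omega>]) auto
    moreover have "T \<subseteq> \<Omega>" using T(2) by auto
    ultimately have I: "(\<integral>x. indicator T x * v x \<partial>?M) = 0"
      by (intro integral_compact_eq_0[OF v 0])
    have TM: "T \<in> sets ?M" using T(1) \<open>T \<subseteq> \<Omega>\<close> by (simp add: sets_restrict_space_iff sets_completionI_sets)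
    have "integrable ?M (\<lambda>x. indicator T x *\<^sub>R v x)"
      using v TM by (intro integrable_mult_indicator)
    moreover have "0 \<le> indicator T x * v x" for x using T(2) by (auto simp: indicator_def)
    ultimately have "AE x in ?M. indicator T x * v x = 0"
      using I integral_nonneg_eq_0_iff_AE[of ?M "\<lambda>x. indicator T x * v x"] by simp
    then have "AE x in ?M. x \<notin> T"
    proof eventually_elim
      case (elim x)
      then show ?case using T(2) by (cases "x \<in> T") auto
    qed
    then have "emeasure ?M ?P = emeasure ?M (?P - T)"
      using PM TM by (intro emeasure_eq_AE) auto
    also have "\<dots> = emeasure lebesgue (?P - T)"
      by (intro emeasure_restrict_space) auto
    finally show ?thesis using T(3) by (simp only: less_imp_le)
  qed
  then have "emeasure ?M ?P \<le> 0 + ennreal e" if "e > 0" for e using that by simp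
  then have "emeasure ?M ?P \<le> 0" by (rule ennreal_le_epsilon)
  then have "emeasure ?M ?P = 0" by simp
  then show ?thesis using PM
    by (intro AE_I[where N = ?P]) (simp_all add: not_le)
qed

lemma fundamental_lemma:
  assumes v: "integrable (lebesgue_on \<Omega>) v"
    and 0: "\<And>\<phi>. \<phi> \<in> test_functions \<Omega> \<Longrightarrow> (\<integral>x. v x * \<phi> x \<partial>lebesgue_on \<Omega>) = 0"
  shows "AE x in lebesgue_on \<Omega>. v x = 0"
proof -
  have "AE x in lebesgue_on \<Omega>. - v x \<le> 0"
    using v 0 by (intro fundamental_lemma_nonpos) auto
  moreover have "AE x in lebesgue_on \<Omega>. v x \<le> 0"
    by (rule fundamental_lemma_nonpos[OF assms])
  ultimately show ?thesis by eventually_elim simp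
qed

section \<open>Weak derivatives and density of test functions\<close>

lemma weak_partial:
  assumes "u \<in> H1 \<Omega>"
  shows "weak_partial \<Omega> i u \<in> L2 (lebesgue_on \<Omega>)" "has_weak_partial \<Omega> i u (weak_partial \<Omega> i u)"
proof -
  have "\<exists>v. v \<in> L2 (lebesgue_on \<Omega>) \<and> has_weak_partial \<Omega> i u v"
    using assms unfolding H1_def by blast
  from someI_ex[OF this]
  show "weak_partial \<Omega> i u \<in> L2 (lebesgue_on \<Omega>)" "has_weak_partial \<Omega> i u (weak_partial \<Omega> i u)"
    by (auto simp: weak_partial_def)
qed

lemma weak_partial_unique:
  assumes "v \<in> L2 (lebesgue_on \<Omega>)" "has_weak_partial \<Omega> i u v"
    and "w \<in> L2 (lebesgue_on \<Omega>)" "has_weak_partial \<Omega> i u w"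
  shows "AE x in lebesgue_on \<Omega>. v x = w x"
proof -
  have "AE x in lebesgue_on \<Omega>. v x - w x = 0"
  proof (rule fundamental_lemma)
    show "integrable (lebesgue_on \<Omega>) (\<lambda>x. v x - w x)"
      by (intro L2_integrable finite_measure_\<Omega> L2_diff assms)
    show "(\<integral>x. (v x - w x) * \<phi> x \<partial>lebesgue_on \<Omega>) = 0" if "\<phi> \<in> test_functions \<Omega>" for \<phi>
      using that assms(2,4) L2_mult_integrable[OF assms(1) test_functions_L2_on[OF that]]
        L2_mult_integrable[OF assms(3) test_functions_L2_on[OF that]]
      by (simp add: has_weak_partial_def left_diff_distrib)
  qed
  then show ?thesis by simp
qed

text \<open>\<open>weak_partial\<close> picks its representative by \<open>SOME\<close>, so
  identities for it are available only almost everywhere. They are obtained by exhibiting some weak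
  derivative and invoking uniqueness.\<close>

lemma weak_partial_eq:
  assumes "u \<in> L2 (lebesgue_on \<Omega>)" "v \<in> L2 (lebesgue_on \<Omega>)" "has_weak_partial \<Omega> i u v"
  shows "AE x in lebesgue_on \<Omega>. weak_partial \<Omega> i u x = v x"
proof -
  have "\<exists>v. v \<in> L2 (lebesgue_on \<Omega>) \<and> has_weak_partial \<Omega> i u v"
    using assms by auto
  from someI_ex[OF this, folded weak_partial_def] show ?thesis
    by (intro weak_partial_unique[OF _ _ assms(2,3)]) simp_all
qed

lemma H1_L2: "u \<in> H1 \<Omega> \<Longrightarrow> u \<in> L2 (lebesgue_on \<Omega>)"
  by (simp add: H1_def)

lemma H10_H1: "u \<in> H10 \<Omega> \<Longrightarrow> u \<in> H1 \<Omega>"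
  by (simp add: H10_def)

lemma has_weak_partial_test_function:
  assumes "u \<in> test_functions \<Omega>"
  shows "has_weak_partial \<Omega> i u (partial_deriv i u)"
  unfolding has_weak_partial_def
proof
  fix \<phi> assume \<phi>: "\<phi> \<in> test_functions \<Omega>"
  note m = test_functions_borel[OF \<phi>] test_functions_borel[OF assms]
    test_functions_borel[OF test_functions_partial_deriv[OF \<phi>]] 
    test_functions_borel[OF test_functions_partial_deriv[OF assms]] test_functions_vanish[OF \<phi>]
    test_functions_vanish[OF assms]
  show "(\<integral>x. u x * partial_deriv i \<phi> x \<partial>lebesgue_on \<Omega>) = - (\<integral>x. partial_deriv i u x * \<phi> x \<partial>lebesgue_on \<Omega>)"
    using integral_by_parts[OF \<phi> test_functions_Ck[OF assms], of i] m
    by (simp add: integral_on_\<Omega>)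
qed

lemma weak_partial_test_function:
  assumes "u \<in> test_functions \<Omega>"
  shows "AE x in lebesgue_on \<Omega>. weak_partial \<Omega> i u x = partial_deriv i u x"
  using assms by (intro weak_partial_eq has_weak_partial_test_function test_functions_L2_on test_functions_partial_deriv)

lemma test_functions_H1: "u \<in> test_functions \<Omega> \<Longrightarrow> u \<in> H1 \<Omega>"
  unfolding H1_def
  using has_weak_partial_test_function test_functions_L2_on test_functions_partial_deriv by blast

lemma has_weak_partial_lincomb:
  assumes "u \<in> H1 \<Omega>" "v \<in> H1 \<Omega>"
  shows "has_weak_partial \<Omega> i (\<lambda>x. a * u x + b * v x)
    (\<lambda>x. a * weak_partial \<Omega> i u x + b * weak_partial \<Omega> i v x)"
  unfolding has_weak_partial_def
proof
  note p = weak_partial[OF assms(1), of i] weak_partial[OF assms(2), of i]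
  fix \<phi> assume \<phi>: "\<phi> \<in> test_functions \<Omega>"
  note t = test_functions_L2_on[OF \<phi>] test_functions_L2_on[OF test_functions_partial_deriv[OF \<phi>], of i]
  note i = L2_mult_integrable[OF H1_L2[OF assms(1)] t(2)] L2_mult_integrable[OF H1_L2[OF assms(2)] t(2)]
    L2_mult_integrable[OF p(1) t(1)] L2_mult_integrable[OF p(3) t(1)]
  show "(\<integral>x. (a * u x + b * v x) * partial_deriv i \<phi> x \<partial>lebesgue_on \<Omega>)
    = - (\<integral>x. (a * weak_partial \<Omega> i u x + b * weak_partial \<Omega> i v x) * \<phi> x \<partial>lebesgue_on \<Omega>)"
    using p(2,4) \<phi> i by (simp add: has_weak_partial_def distrib_right mult.assoc)
qed

lemma H1_lincomb:
  assumes "u \<in> H1 \<Omega>" "v \<in> H1 \<Omega>"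
  shows "(\<lambda>x. a * u x + b * v x) \<in> H1 \<Omega>"
proof -
  have "(\<lambda>x. a * weak_partial \<Omega> i u x + b * weak_partial \<Omega> i v x) \<in> L2 (lebesgue_on \<Omega>)" for i
    by (intro L2_add L2_cmult weak_partial assms)
  moreover have "(\<lambda>x. a * u x + b * v x) \<in> L2 (lebesgue_on \<Omega>)"
    by (intro L2_add L2_cmult H1_L2 assms)
  ultimately show ?thesis
    unfolding H1_def using has_weak_partial_lincomb[OF assms] by blast
qed

lemma weak_partial_lincomb:
  assumes "u \<in> H1 \<Omega>" "v \<in> H1 \<Omega>"
  shows "AE x in lebesgue_on \<Omega>.
    weak_partial \<Omega> i (\<lambda>x. a * u x + b * v x) x = a * weak_partial \<Omega> i u x + b * weak_partial \<Omega> i v x"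
  by (intro weak_partial_eq has_weak_partial_lincomb H1_L2 H1_lincomb L2_add L2_cmult weak_partial assms)

lemma weak_partial_cmult:
  assumes "u \<in> H1 \<Omega>"
  shows "AE x in lebesgue_on \<Omega>. weak_partial \<Omega> i (\<lambda>x. c * u x) x = c * weak_partial \<Omega> i u x"
  using weak_partial_lincomb[OF assms assms, of i c 0] by simp

lemma H1_norm_zero: "H1_norm \<Omega> (\<lambda>x. 0) = 0"
proof -
  have "AE x in lebesgue_on \<Omega>. weak_partial \<Omega> i (\<lambda>x. 0) x = 0" for i
    using weak_partial_test_function[of "\<lambda>x. 0"] by simp
  then have "(\<integral>x. (weak_partial \<Omega> i (\<lambda>x. 0) x)\<^sup>2 \<partial>lebesgue_on \<Omega>) = 0" for i
    by (intro integral_eq_zero_AE) auto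
  then show ?thesis by (simp add: H1_norm_def)
qed

lemma test_functions_H10: "u \<in> test_functions \<Omega> \<Longrightarrow> u \<in> H10 \<Omega>"
  unfolding H10_def H1_tendsto_def
  using test_functions_H1 H1_norm_zero by (auto intro!: exI[of _ "\<lambda>k. u"])

text \<open>\<open>H1_norm\<close> involves the chosen weak derivative of
  \<open>\<phi> k - u\<close>, which almost everywhere is the classical derivative of
  \<open>\<phi> k\<close> minus the weak one of \<open>u\<close>. The separate L2 limits are the
  form in which estimates for test functions are extended to \<open>H10 \<Omega>\<close>.\<close>

lemma H10_approx:
  assumes "u \<in> H10 \<Omega>"
  obtains \<phi> where "\<And>k. \<phi> k \<in> test_functions \<Omega>"
    "(\<lambda>k. l2norm (lebesgue_on \<Omega>) (\<lambda>x. \<phi> k x - u x)) \<longlonglongrightarrow> 0"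
    "\<And>i. (\<lambda>k. l2norm (lebesgue_on \<Omega>) (\<lambda>x. partial_deriv i (\<phi> k) x - weak_partial \<Omega> i u x)) \<longlonglongrightarrow> 0"
proof -
  let ?M = "lebesgue_on \<Omega>"
  obtain \<phi> where \<phi>: "\<And>k. \<phi> k \<in> test_functions \<Omega>" "H1_tendsto \<Omega> \<phi> u"
    using assms by (auto simp: H10_def)
  note u = H10_H1[OF assms]
  let ?d = "\<lambda>k x. \<phi> k x - u x"
  have lim: "(\<lambda>k. H1_norm \<Omega> (?d k)) \<longlonglongrightarrow> 0" using \<phi>(2) by (simp add: H1_tendsto_def)
  have 0: "l2norm ?M (?d k) \<le> H1_norm \<Omega> (?d k)" for k
    by (auto simp: l2norm_def H1_norm_def intro!: sum_nonneg)
  have 1: "l2norm ?M (\<lambda>x. partial_deriv i (\<phi> k) x - weak_partial \<Omega> i u x) \<le> H1_norm \<Omega> (?d k)" for i k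
  proof -
    have ae: "AE x in ?M. weak_partial \<Omega> i (?d k) x = partial_deriv i (\<phi> k) x - weak_partial \<Omega> i u x"
      using weak_partial_lincomb[OF test_functions_H1[OF \<phi>(1)[of k]] u, of i 1 "-1"]
        weak_partial_test_function[OF \<phi>(1)[of k], of i]
      by eventually_elim simp
    have "?d k \<in> H1 \<Omega>"
      using H1_lincomb[OF test_functions_H1[OF \<phi>(1)[of k]] u, of 1 "-1"] by simp
    then have "l2norm ?M (\<lambda>x. partial_deriv i (\<phi> k) x - weak_partial \<Omega> i u x) = l2norm ?M (weak_partial \<Omega> i (?d k))"
      using ae u \<phi>(1) weak_partial(1)
      by (intro l2norm_cong_AE L2_measurable[OF L2_diff] L2_measurable weak_partial(1)
          test_functions_L2_on test_functions_partial_deriv) (auto elim: eventually_mono)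
    also have "\<dots> \<le> H1_norm \<Omega> (?d k)"
      unfolding l2norm_def H1_norm_def
      by (intro real_sqrt_le_mono add_increasing) (auto intro!: member_le_sum)
    finally show ?thesis .
  qed
  show thesis
  proof (rule that[OF \<phi>(1)])
    show "(\<lambda>k. l2norm ?M (?d k)) \<longlonglongrightarrow> 0"
      by (rule Lim_null_comparison[OF _ lim]) (simp add: 0)
    show "(\<lambda>k. l2norm ?M (\<lambda>x. partial_deriv i (\<phi> k) x - weak_partial \<Omega> i u x)) \<longlonglongrightarrow> 0" for i
      by (rule Lim_null_comparison[OF _ lim]) (simp add: 1)
  qed
qed

end

section \<open>Smallness outside the domain\<close>

text \<open>The H1 norm with classical derivatives, taken over the whole space so that it is
  invariant under translations and free of chosen representatives.\<close>

definition test_norm :: "(real ^ 'n \<Rightarrow> real) \<Rightarrow> real"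
  where "test_norm \<phi> =
    sqrt ((\<integral>x. (\<phi> x)\<^sup>2 \<partial>lborel) + (\<Sum>i\<in>UNIV. \<integral>x. (partial_deriv i \<phi> x)\<^sup>2 \<partial>lborel))"

lemma test_norm_square:
  "(test_norm \<phi>)\<^sup>2 = (\<integral>x. (\<phi> x)\<^sup>2 \<partial>lborel) + (\<Sum>i\<in>UNIV. \<integral>x. (partial_deriv i \<phi> x)\<^sup>2 \<partial>lborel)"
  unfolding test_norm_def by (intro real_sqrt_pow2 add_nonneg_nonneg sum_nonneg) auto

lemma test_norm_nonneg [simp]: "0 \<le> test_norm \<phi>"
  unfolding test_norm_def by (intro real_sqrt_ge_zero add_nonneg_nonneg sum_nonneg) auto

lemma l2norm_le_test_norm: "l2norm lborel \<phi> \<le> test_norm \<phi>"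
  unfolding l2norm_def test_norm_def by (auto intro!: sum_nonneg)

lemma test_norm_translate:
  assumes "\<phi> \<in> test_functions S"
  shows "test_norm (\<lambda>x. \<phi> (x + v)) = test_norm \<phi>"
proof -
  have "partial_deriv i (\<lambda>x. \<phi> (x + v)) = (\<lambda>x. partial_deriv i \<phi> (x + v))" for i
    by (rule ext, rule partial_deriv_translate, rule test_functions_differentiable[OF assms])
  moreover have "(\<integral>x. (\<phi> (x + v))\<^sup>2 \<partial>lborel) = (\<integral>x. (\<phi> x)\<^sup>2 \<partial>lborel)"
    using test_functions_borel[OF assms] by (intro integral_translate_lborel) simp
  moreover have "(\<integral>x. (partial_deriv i \<phi> (x + v))\<^sup>2 \<partial>lborel) = (\<integral>x. (partial_deriv i \<phi> x)\<^sup>2 \<partial>lborel)" for i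
    using test_functions_borel[OF test_functions_partial_deriv[OF assms, of i]]
    by (intro integral_translate_lborel) simp
  ultimately show ?thesis by (simp add: test_norm_def)
qed

text \<open>The product rule with \<open>(a + b)^2 \<le> 2 a^2 + 2 b^2\<close>; the term with
  \<open>B^2\<close> arises once in each of the \<open>CARD('n)\<close> directions.\<close>

lemma test_norm_mult_le:
  fixes f :: "real ^ 'n \<Rightarrow> real"
  assumes f: "\<And>k. Ck k f" "\<And>x. \<bar>f x\<bar> \<le> 1" "\<And>i x. \<bar>partial_deriv i f x\<bar> \<le> B"
    and \<phi>: "\<phi> \<in> test_functions S"
  shows "test_norm (\<lambda>x. f x * \<phi> x) \<le> sqrt (2 + 2 * real CARD('n) * B\<^sup>2) * test_norm \<phi>"
proof -
  let ?I = "\<integral>x. (\<phi> x)\<^sup>2 \<partial>lborel" and ?J = "\<lambda>i. \<integral>x. (partial_deriv i \<phi> x)\<^sup>2 \<partial>lborel"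
  note p = test_functions_partial_deriv[OF \<phi>]
  have d: "f differentiable at x" for x using f(1)[of "Suc 0"] by simp
  have f': "Ck k (partial_deriv i f)" for k i using f(1)[of "Suc k"] by simp
  have int: "integrable lborel (\<lambda>x. (\<phi> x)\<^sup>2)" "integrable lborel (\<lambda>x. (partial_deriv i \<phi> x)\<^sup>2)" for i
    using test_functions_L2[OF \<phi>] test_functions_L2[OF p] by (simp_all add: L2_def)
  have 0: "(\<integral>x. (f x * \<phi> x)\<^sup>2 \<partial>lborel) \<le> ?I"
  proof (rule integral_mono)
    show "integrable lborel (\<lambda>x. (f x * \<phi> x)\<^sup>2)"
      using test_functions_L2[OF test_functions_mult[OF \<phi> f(1)]] by (simp add: L2_def)
    show "(f x * \<phi> x)\<^sup>2 \<le> (\<phi> x)\<^sup>2" for x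
      using f(2)[of x] by (simp add: abs_le_square_iff[symmetric] abs_mult mult_left_le_one_le)
  qed (rule int)
  have 1: "(\<integral>x. (partial_deriv i (\<lambda>x. f x * \<phi> x) x)\<^sup>2 \<partial>lborel) \<le> 2 * ?J i + 2 * B\<^sup>2 * ?I" for i
  proof -
    have "(\<integral>x. (partial_deriv i (\<lambda>x. f x * \<phi> x) x)\<^sup>2 \<partial>lborel)
      \<le> (\<integral>x. 2 * (partial_deriv i \<phi> x)\<^sup>2 + 2 * B\<^sup>2 * (\<phi> x)\<^sup>2 \<partial>lborel)"
    proof (rule integral_mono)
      show "integrable lborel (\<lambda>x. (partial_deriv i (\<lambda>x. f x * \<phi> x) x)\<^sup>2)"
        using test_functions_L2[OF test_functions_partial_deriv[OF test_functions_mult[OF \<phi> f(1)]]]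
        by (simp add: L2_def)
      show "integrable lborel (\<lambda>x. 2 * (partial_deriv i \<phi> x)\<^sup>2 + 2 * B\<^sup>2 * (\<phi> x)\<^sup>2)"
        using int by simp
      fix x
      let ?a = "f x * partial_deriv i \<phi> x" and ?b = "partial_deriv i f x * \<phi> x"
      have "(?a + ?b)\<^sup>2 \<le> 2 * ?a\<^sup>2 + 2 * ?b\<^sup>2"
        using zero_le_power2[of "?a - ?b"] by (simp add: power2_sum power2_diff)
      also have "?a\<^sup>2 \<le> (partial_deriv i \<phi> x)\<^sup>2"
        using f(2)[of x] by (simp add: abs_le_square_iff[symmetric] abs_mult mult_left_le_one_le)
      also have "?b\<^sup>2 \<le> B\<^sup>2 * (\<phi> x)\<^sup>2"
        unfolding power_mult_distrib
        using f(3)[of i x] by (intro mult_right_mono) (auto simp: abs_le_square_iff[symmetric])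
      finally show "(partial_deriv i (\<lambda>x. f x * \<phi> x) x)\<^sup>2 \<le> 2 * (partial_deriv i \<phi> x)\<^sup>2 + 2 * B\<^sup>2 * (\<phi> x)\<^sup>2"
        by (simp add: partial_deriv_mult d test_functions_differentiable[OF \<phi>])
    qed
    also have "\<dots> = 2 * ?J i + 2 * B\<^sup>2 * ?I" using int by simp
    finally show ?thesis .
  qed
  have "(test_norm (\<lambda>x. f x * \<phi> x))\<^sup>2 \<le> ?I + (\<Sum>i\<in>UNIV. 2 * ?J i + 2 * B\<^sup>2 * ?I)"
    unfolding test_norm_square by (intro add_mono 0 sum_mono 1)
  also have "\<dots> = ?I + 2 * (\<Sum>i\<in>UNIV. ?J i) + 2 * real CARD('n) * B\<^sup>2 * ?I"
    by (simp add: sum.distrib sum_distrib_left)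
  also have "\<dots> \<le> (2 + 2 * real CARD('n) * B\<^sup>2) * (test_norm \<phi>)\<^sup>2"
  proof -
    have "0 \<le> ?I" "0 \<le> (\<Sum>i\<in>UNIV. ?J i)" "0 \<le> 2 * real CARD('n) * B\<^sup>2 * (\<Sum>i\<in>UNIV. ?J i)"
      by (auto intro!: sum_nonneg mult_nonneg_nonneg)
    then show ?thesis unfolding test_norm_square by (simp add: algebra_simps)
  qed
  also have "\<dots> = (sqrt (2 + 2 * real CARD('n) * B\<^sup>2) * test_norm \<phi>)\<^sup>2"
    by (simp add: power_mult_distrib)
  finally show ?thesis by (rule power2_le_imp_le) simp
qed

text \<open>One constant serves both factors, since the derivatives of \<open>\<eta>\<close> and
  \<open>1 - \<eta>\<close> differ only in sign.\<close>

lemma test_norm_cutoff_le: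
  fixes \<eta> :: "real ^ 'n \<Rightarrow> real"
  assumes \<eta>: "\<eta> \<in> test_functions S'" "\<And>x. 0 \<le> \<eta> x" "\<And>x. \<eta> x \<le> 1"
  obtains M where "M > 0"
    "\<And>\<phi> S. \<phi> \<in> test_functions S \<Longrightarrow> test_norm (\<lambda>x. \<eta> x * \<phi> x) \<le> M * test_norm \<phi>"
    "\<And>\<phi> S. \<phi> \<in> test_functions S \<Longrightarrow> test_norm (\<lambda>x. (1 - \<eta> x) * \<phi> x) \<le> M * test_norm \<phi>"
proof -
  have "\<exists>B>0. \<forall>x. \<bar>partial_deriv i \<eta> x\<bar> \<le> B" for i
    using test_functions_bounded[OF test_functions_partial_deriv[OF \<eta>(1)]] by metis
  then obtain b where b: "\<And>i. b i > 0" "\<And>i x. \<bar>partial_deriv i \<eta> x\<bar> \<le> b i" by metis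
  let ?B = "\<Sum>i\<in>UNIV. b i"
  have bi: "b i \<le> ?B" for i using b(1) by (intro member_le_sum) (auto simp: less_imp_le)
  have B: "\<bar>partial_deriv i \<eta> x\<bar> \<le> ?B" for i x
    using bi b(2) order_trans by blast
  have d: "\<eta> differentiable at x" for x by (rule test_functions_differentiable[OF \<eta>(1)])
  have "partial_deriv i (\<lambda>x. 1 - \<eta> x) x = - partial_deriv i \<eta> x" for i x
    by (subst partial_deriv_eq[OF has_derivative_diff[OF has_derivative_const differentiable_has_derivative[OF d]]])
       (simp add: partial_deriv_def)
  then have B': "\<bar>partial_deriv i (\<lambda>x. 1 - \<eta> x) x\<bar> \<le> ?B" for i x using B by simp
  show thesis
  proof
    show "sqrt (2 + 2 * real CARD('n) * ?B\<^sup>2) > 0" 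
      by (intro real_sqrt_gt_zero add_pos_nonneg) auto
    show "test_norm (\<lambda>x. \<eta> x * \<phi> x) \<le> sqrt (2 + 2 * real CARD('n) * ?B\<^sup>2) * test_norm \<phi>"
      if "\<phi> \<in> test_functions S" for \<phi> S
      by (rule test_norm_mult_le[OF test_functions_Ck[OF \<eta>(1)] _ B that]) (simp add: \<eta>)
    show "test_norm (\<lambda>x. (1 - \<eta> x) * \<phi> x) \<le> sqrt (2 + 2 * real CARD('n) * ?B\<^sup>2) * test_norm \<phi>"
      if "\<phi> \<in> test_functions S" for \<phi> S
      by (rule test_norm_mult_le[OF Ck_diff[OF Ck_const test_functions_Ck[OF \<eta>(1)]] _ B' that]) (simp add: \<eta>)
  qed
qed

lemma test_functions_uniformly_continuous:
  fixes q :: "real ^ 'n \<Rightarrow> real"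
  assumes "q \<in> test_functions S" "e > 0"
  obtains d where "d > 0" "\<And>x y. dist x y < d \<Longrightarrow> \<bar>q x - q y\<bar> < e"
proof -
  obtain K where K: "compact K" "\<And>x. x \<notin> K \<Longrightarrow> q x = 0"
    using assms by (metis test_functionsE)
  obtain R where R: "R > 0" "\<And>x. x \<in> K \<Longrightarrow> norm x \<le> R"
    using compact_imp_bounded[OF K(1)] bounded_pos by metis
  have "uniformly_continuous_on (cball 0 (R + 1)) q"
    by (intro compact_uniformly_continuous continuous_on_subset[OF test_functions_continuous[OF assms(1)]]) auto
  then obtain d where d: "d > 0"
    "\<And>x y. x \<in> cball 0 (R + 1) \<Longrightarrow> y \<in> cball 0 (R + 1) \<Longrightarrow> dist y x < d \<Longrightarrow> dist (q y) (q x) < e"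
    using assms(2) unfolding uniformly_continuous_on_def by metis
  \<comment> \<open>If one of two points at distance less than 1 lies in \<open>K\<close>, both lie
    in the ball of radius \<open>R + 1\<close>; if neither does, \<open>q\<close> vanishes at
    both.\<close>
  show thesis
  proof (rule that[of "min d 1"])
    fix x y :: "real ^ 'n" assume xy: "dist x y < min d 1"
    show "\<bar>q x - q y\<bar> < e"
    proof (cases "x \<in> K \<or> y \<in> K")
      case True
      have "norm x \<le> norm y + dist x y" "norm y \<le> norm x + dist x y"
        by (simp_all add: dist_norm norm_triangle_sub norm_minus_commute) (metis norm_minus_commute norm_triangle_sub)
      then have "x \<in> cball 0 (R + 1)" "y \<in> cball 0 (R + 1)" using True R xy by fastforce+
      then show ?thesis using d(2)[of y x] xy by (simp add: dist_real_def)
    next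
      case False
      then show ?thesis using K(2) assms(2) by simp
    qed
  qed (use d in simp)
qed

section \<open>Shifting along the axis of a chart\<close>

lemma hproj_shift: "norm e = 1 \<Longrightarrow> hproj e (x + t *\<^sub>R e) = hproj e x"
  by (simp add: hproj_def inner_add_left algebra_simps norm_eq_1)

text \<open>The shift keeps \<open>hproj e\<close> and lowers the height by \<open>t\<close>, so a
  point on or below the graph ends strictly below it, which inside \<open>U\<close> means in
  \<open>A\<close>. The graph description of the boundary enters the estimates through this
  fact.\<close>

lemma lipschitz_chart_shift:
  assumes "lipschitz_chart A U e \<gamma>" "t > 0" "y \<in> closure A" "y \<in> U" "y - t *\<^sub>R e \<in> U"
  shows "y - t *\<^sub>R e \<in> A"
proof -
  have e: "norm e = 1" and F: "frontier A \<inter> U = {x \<in> U. x \<bullet> e = \<gamma> (hproj e x)}"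
    and A: "A \<inter> U = {x \<in> U. x \<bullet> e < \<gamma> (hproj e x)}"
    using assms(1) by (auto simp: lipschitz_chart_def)
  have "y \<in> A \<or> y \<in> frontier A" using assms(3) interior_subset[of A] by (auto simp: frontier_def)
  then have "y \<in> A \<inter> U \<or> y \<in> frontier A \<inter> U" using assms(4) by blast
  then have "y \<bullet> e \<le> \<gamma> (hproj e y)" unfolding A F by auto
  moreover have "hproj e (y - t *\<^sub>R e) = hproj e y" using hproj_shift[OF e, of y "-t"] by simp
  moreover have "(y - t *\<^sub>R e) \<bullet> e = y \<bullet> e - t" using e by (simp add: inner_diff_left norm_eq_1)
  ultimately have "y - t *\<^sub>R e \<in> A \<inter> U" using assms(2,5) unfolding A by simp
  then show ?thesis by blast
qed

lemma l2norm_mono: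
  assumes "g \<in> L2 M" "\<And>x. \<bar>f x\<bar> \<le> \<bar>g x\<bar>"
  shows "l2norm M f \<le> l2norm M g"
  unfolding l2norm_def
  using assms by (intro real_sqrt_le_mono integral_mono') (auto simp: L2_def abs_le_square_iff)

lemma L2_indicator_mult:
  assumes "f \<in> L2 M" "B \<in> sets M"
  shows "(\<lambda>x. indicator B x * f x) \<in> L2 M"
proof -
  have "(\<lambda>x. (indicator B x * f x)\<^sup>2) = (\<lambda>x. indicator B x *\<^sub>R (f x)\<^sup>2)"
    by (auto simp: indicator_def fun_eq_iff)
  then show ?thesis
    using assms integrable_mult_indicator[OF assms(2) L2_square_integrable[OF assms(1)]]
    by (simp add: L2_def borel_measurable_times)
qed

text \<open>\<open>G\<close> is reduced to the properties that the estimate uses.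
  \<open>G_approx\<close> says that, in the dual of the H1 norm, \<open>G\<close> is a limit of
  functionals with densities \<open>q\<close> that are test functions; such a density yields L2
  bounds at the price of an error \<open>\<epsilon> * test_norm \<phi>\<close>.\<close>

locale localized_functional = bounded_open_set \<Omega> for \<Omega> :: "(real ^ 'n) set" +
  fixes A :: "(real ^ 'n) set" and G :: "(real ^ 'n \<Rightarrow> real) \<Rightarrow> real"
  assumes open_A: "open A" and closure_A: "closure A \<subseteq> \<Omega>" and lip_A: "lipschitz_boundary A"
    and G_add: "\<And>\<phi> \<psi>. \<phi> \<in> test_functions \<Omega> \<Longrightarrow> \<psi> \<in> test_functions \<Omega> \<Longrightarrow>
      G (\<lambda>x. \<phi> x + \<psi> x) = G \<phi> + G \<psi>"
    and G_A: "\<And>\<phi>. \<phi> \<in> test_functions A \<Longrightarrow> G \<phi> = 0"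
    and G_approx: "\<And>\<epsilon>. \<epsilon> > 0 \<Longrightarrow> \<exists>q \<in> test_functions \<Omega>. \<forall>\<phi> \<in> test_functions \<Omega>.
      \<bar>G \<phi> - (\<integral>x. q x * \<phi> x \<partial>lborel)\<bar> \<le> \<epsilon> * test_norm \<phi>"
begin

definition outer_norm :: "(real ^ 'n \<Rightarrow> real) \<Rightarrow> real"
  where "outer_norm \<phi> = l2norm lborel (\<lambda>x. indicator (- A) x * \<phi> x)"

text \<open>The desired estimate for functions living in \<open>S\<close>, with a constant that may
  depend on \<open>S\<close> and \<open>\<epsilon>\<close>. The set of nonzeros is used rather than
  its closure, so that multiplication by a cutoff vanishing off an open ball leads directly to
  functions of this kind.\<close>

definition controlled :: "(real ^ 'n) set \<Rightarrow> bool"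
  where "controlled S \<longleftrightarrow> (\<forall>\<epsilon>>0. \<exists>C\<ge>0. \<forall>\<phi> \<in> test_functions \<Omega>. {x. \<phi> x \<noteq> 0} \<subseteq> S \<longrightarrow>
    \<bar>G \<phi>\<bar> \<le> \<epsilon> * test_norm \<phi> + C * outer_norm \<phi>)"

lemma outer_norm_nonneg [simp]: "0 \<le> outer_norm \<phi>"
  by (simp add: outer_norm_def)

lemma outer_L2: "\<phi> \<in> test_functions S \<Longrightarrow> (\<lambda>x. indicator (- A) x * \<phi> x) \<in> L2 lborel"
  using open_A by (intro L2_indicator_mult test_functions_L2) auto

lemma controlled_empty: "controlled {}"
proof -
  have "G \<phi> = 0" if "{x. \<phi> x \<noteq> 0} \<subseteq> {}" for \<phi>
  proof -
    have "\<phi> = (\<lambda>x. 0)" using that by auto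
    then show ?thesis using G_A[of "\<lambda>x. 0"] by simp
  qed
  then show ?thesis unfolding controlled_def by (intro allI impI exI[of _ 0]) simp
qed

text \<open>A smooth function vanishing off \<open>ball x r\<close> is supported in the compact set
  \<open>cball x r\<close>, hence is a test function of \<open>A\<close> and is annihilated by
  \<open>G\<close>.\<close>

lemma controlled_interior:
  assumes "cball x r \<subseteq> A"
  shows "controlled (ball x r)"
proof -
  have "G \<phi> = 0" if "\<phi> \<in> test_functions \<Omega>" "{x. \<phi> x \<noteq> 0} \<subseteq> ball x r" for \<phi>
  proof (rule G_A, rule test_functionsI)
    show "Ck k \<phi>" for k by (rule test_functions_Ck[OF that(1)])
    show "\<phi> y = 0" if "y \<notin> cball x r" for y using that \<open>{x. \<phi> x \<noteq> 0} \<subseteq> ball x r\<close> by auto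
  qed (use assms in auto)
  then show ?thesis unfolding controlled_def by (intro allI impI exI[of _ 0]) simp
qed

text \<open>Away from \<open>A\<close> the outer norm is the full L2 norm, so the Cauchy-Schwarz
  inequality with an approximating density \<open>q\<close> is enough.\<close>

lemma controlled_exterior:
  assumes "ball x r \<inter> A = {}"
  shows "controlled (ball x r)"
  unfolding controlled_def
proof (intro allI impI)
  fix \<epsilon> :: real assume "\<epsilon> > 0"
  then obtain q where q: "q \<in> test_functions \<Omega>"
    "\<And>\<phi>. \<phi> \<in> test_functions \<Omega> \<Longrightarrow> \<bar>G \<phi> - (\<integral>x. q x * \<phi> x \<partial>lborel)\<bar> \<le> \<epsilon> * test_norm \<phi>"
    using G_approx by blast
  show "\<exists>C\<ge>0. \<forall>\<phi>\<in>test_functions \<Omega>. {x. \<phi> x \<noteq> 0} \<subseteq> ball x r \<longrightarrow>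
      \<bar>G \<phi>\<bar> \<le> \<epsilon> * test_norm \<phi> + C * outer_norm \<phi>"
  proof (intro exI[of _ "l2norm lborel q"] conjI ballI impI)
    fix \<phi> assume \<phi>: "\<phi> \<in> test_functions \<Omega>" "{x. \<phi> x \<noteq> 0} \<subseteq> ball x r"
    have "(\<lambda>x. indicator (- A) x * \<phi> x) = \<phi>"
      using \<phi>(2) assms by (fastforce simp: indicator_def fun_eq_iff)
    then have on: "outer_norm \<phi> = l2norm lborel \<phi>" by (simp add: outer_norm_def)
    show "\<bar>G \<phi>\<bar> \<le> \<epsilon> * test_norm \<phi> + l2norm lborel q * outer_norm \<phi>"
      using q(2)[OF \<phi>(1)] L2_cauchy_schwarz[OF test_functions_L2[OF q(1)] test_functions_L2[OF \<phi>(1)]]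
      unfolding on by linarith
  qed simp
qed

text \<open>The budget \<open>\<epsilon>\<close> is spent in quarters: three on
  \<open>G \<phi> - G \<psi>\<close> for the translate \<open>\<psi>\<close> of
  \<open>\<phi>\<close>, estimated through \<open>q\<close>, and one on the part of
  \<open>\<psi>\<close> that the cutoff leaves over. The order of choices is forced:
  \<open>q\<close>, then the shift \<open>t\<close>, then \<open>\<eta>\<close> with its constant
  \<open>M\<close>, then the density \<open>p\<close>. None of them may depend on
  \<open>\<phi>\<close>.\<close>

lemma controlled_boundary:
  assumes chart: "lipschitz_chart A U e \<gamma>" and r: "r > 0" "cball x0 (2 * r) \<subseteq> U" "cball x0 (2 * r) \<subseteq> \<Omega>"
  shows "controlled (ball x0 r)"
  unfolding controlled_def
proof (intro allI impI)
  fix \<epsilon> :: real assume \<epsilon>: "\<epsilon> > 0"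
  have e: "norm e = 1" using chart by (simp add: lipschitz_chart_def)
  obtain q where q: "q \<in> test_functions \<Omega>"
    "\<And>\<phi>. \<phi> \<in> test_functions \<Omega> \<Longrightarrow> \<bar>G \<phi> - (\<integral>x. q x * \<phi> x \<partial>lborel)\<bar> \<le> \<epsilon> / 4 * test_norm \<phi>"
    using G_approx[of "\<epsilon> / 4"] \<epsilon> by auto
  \<comment> \<open>Turns a uniform bound on differences of values of \<open>q\<close> into a
    multiple of \<open>l2norm lborel \<phi>\<close> for \<open>\<phi>\<close> living in the
    ball.\<close>
  define m where "m = l2norm lborel (\<lambda>x. indicator (ball x0 r) x :: real)"
  have m: "m \<ge> 0" by (simp add: m_def)
  have ball_L2: "(\<lambda>x. indicator (ball x0 r) x) \<in> L2 lborel"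
    using emeasure_lborel_ball_finite[of x0 r] borel_measurable_indicator[of "ball x0 r" borel]
    by (simp add: L2_def power2_eq_square flip: indicator_inter_arith)
  define \<theta> where "\<theta> = \<epsilon> / (4 * (1 + m))"
  have \<theta>: "\<theta> > 0" "\<theta> * m \<le> \<epsilon> / 4" using \<epsilon> m by (auto simp: \<theta>_def field_simps)
  obtain d where d: "d > 0" "\<And>x y. dist x y < d \<Longrightarrow> \<bar>q x - q y\<bar> < \<theta>"
    using test_functions_uniformly_continuous[OF q(1) \<theta>(1)] by metis
  \<comment> \<open>Less than \<open>d\<close> for the uniform continuity of \<open>q\<close>, and
    at most \<open>r\<close> so that shifted points of \<open>cball x0 r\<close> stay in
    \<open>cball x0 (2 * r)\<close>, which lies in both the chart and
    \<open>\<Omega>\<close>.\<close>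
  define t where "t = min (d / 2) r"
  have t: "t > 0" "t < d" "t \<le> r" using d(1) r(1) by (auto simp: t_def)
  \<comment> \<open>Shifted by \<open>- t\<close> along the axis, the part of
    \<open>closure A\<close> in the ball becomes a compact subset of the open set \<open>A\<close>,
    which leaves room for a cutoff.\<close>
  let ?K = "(\<lambda>y. y - t *\<^sub>R e) ` (closure A \<inter> cball x0 r)"
  have shift: "y - t *\<^sub>R e \<in> cball x0 (2 * r)" if "y \<in> cball x0 r" for y
  proof -
    have "dist x0 (y - t *\<^sub>R e) \<le> dist x0 y + dist y (y - t *\<^sub>R e)" by (rule dist_triangle)
    then show ?thesis using that t e by (simp add: dist_norm)
  qed
  have "compact ?K"
    by (intro compact_continuous_image continuous_intros) (simp add: closed_Int_compact)
  moreover have "?K \<subseteq> A"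
  proof
    fix z assume "z \<in> ?K"
    then obtain y where y: "z = y - t *\<^sub>R e" "y \<in> closure A" "y \<in> cball x0 r" by blast
    have "y \<in> U" using y(3) r by (auto intro!: subsetD[OF r(2)])
    then show "z \<in> A"
      using lipschitz_chart_shift[OF chart t(1) y(2)] shift[OF y(3)] r(2) y(1) by blast
  qed
  ultimately obtain \<eta> where \<eta>: "\<eta> \<in> test_functions A" "\<And>x. 0 \<le> \<eta> x" "\<And>x. \<eta> x \<le> 1" "\<And>x. x \<in> ?K \<Longrightarrow> \<eta> x = 1"
    using test_functions_cutoff_exists[OF _ open_A] by metis
  obtain M where M: "M > 0"
    "\<And>\<phi> S. \<phi> \<in> test_functions S \<Longrightarrow> test_norm (\<lambda>x. (1 - \<eta> x) * \<phi> x) \<le> M * test_norm \<phi>"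
    by (rule test_norm_cutoff_le[OF \<eta>(1-3)]) blast
  \<comment> \<open>The density \<open>q\<close> is not accurate enough here: multiplication by
    \<open>1 - \<eta>\<close> may inflate the norm by \<open>M\<close>, and \<open>M\<close> is
    known only after \<open>q\<close> has fixed the shift.\<close>
  obtain p where p: "p \<in> test_functions \<Omega>"
    "\<And>\<phi>. \<phi> \<in> test_functions \<Omega> \<Longrightarrow> \<bar>G \<phi> - (\<integral>x. p x * \<phi> x \<partial>lborel)\<bar> \<le> \<epsilon> / (4 * M) * test_norm \<phi>"
    using G_approx[of "\<epsilon> / (4 * M)"] \<epsilon> M(1) by auto
  show "\<exists>C\<ge>0. \<forall>\<phi>\<in>test_functions \<Omega>. {x. \<phi> x \<noteq> 0} \<subseteq> ball x0 r \<longrightarrow>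
      \<bar>G \<phi>\<bar> \<le> \<epsilon> * test_norm \<phi> + C * outer_norm \<phi>"
  proof (intro exI[of _ "l2norm lborel p"] conjI ballI impI)
    fix \<phi> assume \<phi>: "\<phi> \<in> test_functions \<Omega>" "{x. \<phi> x \<noteq> 0} \<subseteq> ball x0 r"
    define \<psi> where "\<psi> = (\<lambda>x. \<phi> (x + t *\<^sub>R e))"
    have \<phi>0: "\<phi> y = 0" if "y \<notin> ball x0 r" for y using \<phi>(2) that by blast
    have \<psi>: "\<psi> \<in> test_functions \<Omega>"
    proof (rule test_functionsI)
      show "Ck k \<psi>" for k unfolding \<psi>_def by (rule Ck_translate[OF test_functions_Ck[OF \<phi>(1)]])
      show "\<psi> y = 0" if "y \<notin> cball x0 (2 * r)" for y
        using \<phi>0[of "y + t *\<^sub>R e"] shift[of "y + t *\<^sub>R e"] that unfolding \<psi>_def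
        by (auto simp del: mem_ball mem_cball dest: subsetD[OF ball_subset_cball])
    qed (use r in auto)
    have n\<psi>: "test_norm \<psi> = test_norm \<phi>" unfolding \<psi>_def by (rule test_norm_translate[OF \<phi>(1)])
    let ?D = "\<lambda>x. q x - q (x - t *\<^sub>R e)"
    have [measurable]: "q \<in> borel_measurable borel" "\<phi> \<in> borel_measurable borel"
      using test_functions_borel q(1) \<phi>(1) by auto
    have q\<phi>: "integrable lborel (\<lambda>x. q x * \<phi> x)"
      by (intro L2_mult_integrable test_functions_L2[OF q(1)] test_functions_L2[OF \<phi>(1)])
    have q'\<phi>: "integrable lborel (\<lambda>x. q (x - t *\<^sub>R e) * \<phi> x)"
      using test_functions_integrable[OF test_functions_mult[OF \<phi>(1) Ck_translate[OF test_functions_Ck[OF q(1)], where v = "- (t *\<^sub>R e)"]]]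
      by simp
    \<comment> \<open>The shift is transferred from \<open>\<phi>\<close> to \<open>q\<close>, whose
      modulus of continuity is independent of \<open>\<phi>\<close>.\<close>
    have "(\<integral>x. q x * \<psi> x \<partial>lborel) = (\<integral>x. q (x - t *\<^sub>R e) * \<phi> x \<partial>lborel)"
      using integral_translate_lborel[of "\<lambda>x. q (x - t *\<^sub>R e) * \<phi> x" "t *\<^sub>R e"]
      by (simp add: \<psi>_def)
    then have "(\<integral>x. q x * \<phi> x \<partial>lborel) - (\<integral>x. q x * \<psi> x \<partial>lborel) = (\<integral>x. ?D x * \<phi> x \<partial>lborel)"
      using q\<phi> q'\<phi> by (simp add: left_diff_distrib)
    also have "\<bar>\<dots>\<bar> \<le> (\<integral>x. \<theta> * (indicator (ball x0 r) x * \<bar>\<phi> x\<bar>) \<partial>lborel)"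
    proof (rule integral_abs_bound_integral)
      show "integrable lborel (\<lambda>x. ?D x * \<phi> x)"
        using q\<phi> q'\<phi> by (simp add: left_diff_distrib)
      show "integrable lborel (\<lambda>x. \<theta> * (indicator (ball x0 r) x * \<bar>\<phi> x\<bar>))"
        using test_functions_L2[OF \<phi>(1)]
        by (intro integrable_mult_right L2_mult_integrable ball_L2) (simp add: L2_def)
      show "\<bar>?D x * \<phi> x\<bar> \<le> \<theta> * (indicator (ball x0 r) x * \<bar>\<phi> x\<bar>)" for x
      proof (cases "x \<in> ball x0 r")
        case True
        have "\<bar>?D x\<bar> \<le> \<theta>" using d(2)[of x "x - t *\<^sub>R e"] t e by (simp add: dist_norm less_imp_le)
        then show ?thesis using True by (simp add: abs_mult mult_right_mono)
      qed (simp add: \<phi>0)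
    qed
    also have "\<dots> \<le> \<theta> * (m * l2norm lborel \<phi>)"
      using L2_cauchy_schwarz[OF ball_L2, of "\<lambda>x. \<bar>\<phi> x\<bar>"] test_functions_L2[OF \<phi>(1)] \<theta>(1)
      by (simp add: m_def l2norm_def L2_def)
    also have "\<dots> \<le> \<epsilon> / 4 * test_norm \<phi>"
      unfolding mult.assoc[symmetric] using \<theta> \<epsilon> l2norm_le_test_norm[of \<phi>] by (intro mult_mono) auto
    finally have I: "\<bar>(\<integral>x. q x * \<phi> x \<partial>lborel) - (\<integral>x. q x * \<psi> x \<partial>lborel)\<bar> \<le> \<epsilon> / 4 * test_norm \<phi>" .
    have 1: "\<bar>G \<phi> - G \<psi>\<bar> \<le> 3 * (\<epsilon> / 4 * test_norm \<phi>)"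
      using I q(2)[OF \<phi>(1)] q(2)[OF \<psi>] unfolding n\<psi> by linarith
    let ?\<rho> = "\<lambda>x. (1 - \<eta> x) * \<psi> x"
    have C\<eta>: "Ck k \<eta>" for k by (rule test_functions_Ck[OF \<eta>(1)])
    have \<rho>: "?\<rho> \<in> test_functions \<Omega>" by (intro test_functions_mult \<psi> Ck_diff Ck_const C\<eta>)
    have \<eta>\<psi>: "(\<lambda>x. \<eta> x * \<psi> x) \<in> test_functions \<Omega>" by (intro test_functions_mult \<psi> C\<eta>)
    have "G (\<lambda>x. \<psi> x * \<eta> x) = 0"
      by (intro G_A test_functions_mult \<eta>(1) test_functions_Ck[OF \<psi>])
    then have "G \<psi> = G ?\<rho>"
      using G_add[OF \<eta>\<psi> \<rho>] by (simp add: algebra_simps)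
    also have "\<bar>G ?\<rho>\<bar> \<le> \<bar>\<integral>x. p x * ?\<rho> x \<partial>lborel\<bar> + \<epsilon> / (4 * M) * test_norm ?\<rho>"
      using p(2)[OF \<rho>] by linarith
    also have "\<epsilon> / (4 * M) * test_norm ?\<rho> \<le> \<epsilon> / (4 * M) * (M * test_norm \<phi>)"
      using M(2)[OF \<psi>] \<epsilon> M(1) unfolding n\<psi> by (intro mult_left_mono) auto
    also have "\<bar>\<integral>x. p x * ?\<rho> x \<partial>lborel\<bar> \<le> l2norm lborel p * l2norm lborel ?\<rho>"
      by (intro L2_cauchy_schwarz test_functions_L2[OF p(1)] test_functions_L2[OF \<rho>])
    \<comment> \<open>Where \<open>?\<rho>\<close> is nonzero, \<open>x\<close> lies outside
      \<open>?K\<close> while its shift by \<open>t\<close> along \<open>e\<close> lies in the ball;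
      hence the shifted point is not in \<open>closure A\<close>. So \<open>?\<rho>\<close> is
      dominated by a translate of \<open>\<phi>\<close> cut off to the complement of
      \<open>A\<close>, and translation preserves the norm.\<close>
    also have "l2norm lborel ?\<rho> \<le> outer_norm \<phi>"
    proof -
      let ?g = "\<lambda>x. indicator (- A) x * \<phi> x"
      have [measurable]: "A \<in> sets borel" using open_A by simp
      have g: "?g \<in> borel_measurable borel" by measurable
      have tr: "l2norm lborel (\<lambda>x. ?g (x + t *\<^sub>R e)) = l2norm lborel ?g"
        using g unfolding l2norm_def by (subst integral_translate_lborel[of "\<lambda>x. (?g x)\<^sup>2"]) simp_all
      have "(\<lambda>x. ?g (x + t *\<^sub>R e)) \<in> L2 lborel"
      proof -
        have "integrable (distr lborel borel ((+) (t *\<^sub>R e))) (\<lambda>x. (?g x)\<^sup>2)"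
          using outer_L2[OF \<phi>(1)] by (simp add: lborel_distr_plus L2_def)
        then have "integrable lborel (\<lambda>x. (?g (x + t *\<^sub>R e))\<^sup>2)"
          using g by (subst (asm) integrable_distr_eq) (auto simp: add.commute)
        moreover have "(\<lambda>x. ?g (x + t *\<^sub>R e)) \<in> borel_measurable borel" by measurable
        ultimately show ?thesis by (simp add: L2_def)
      qed
      then have "l2norm lborel ?\<rho> \<le> l2norm lborel (\<lambda>x. ?g (x + t *\<^sub>R e))"
      proof (rule l2norm_mono)
        fix x
        show "\<bar>?\<rho> x\<bar> \<le> \<bar>?g (x + t *\<^sub>R e)\<bar>"
        proof (cases "\<eta> x = 1 \<or> \<psi> x = 0")
          case False
          then have "x + t *\<^sub>R e \<in> ball x0 r" using \<phi>0 by (auto simp: \<psi>_def)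
          moreover have "x \<notin> ?K" using False \<eta>(4) by blast
          ultimately have "x + t *\<^sub>R e \<notin> closure A"
            by (auto simp: image_iff dest!: bspec[of _ _ "x + t *\<^sub>R e"])
          then have "x + t *\<^sub>R e \<notin> A" using closure_subset by blast
          then show ?thesis using \<eta>(2,3)[of x] by (simp add: \<psi>_def abs_mult mult_left_le_one_le)
        qed auto
      qed
      then show ?thesis unfolding tr outer_norm_def .
    qed
    finally have "\<bar>G \<psi>\<bar> \<le> l2norm lborel p * outer_norm \<phi> + \<epsilon> / 4 * test_norm \<phi>"
      using M(1) by (simp add: mult_left_mono)
    then show "\<bar>G \<phi>\<bar> \<le> \<epsilon> * test_norm \<phi> + l2norm lborel p * outer_norm \<phi>"
      using 1 by linarith
  qed simp
qed

lemma controlled_ball_exists: "\<exists>r>0. controlled (ball x r)"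
proof -
  consider "x \<in> A" | "x \<notin> closure A" | "x \<in> frontier A"
    using open_A by (auto simp: frontier_def interior_open)
  then show ?thesis
  proof cases
    case 1
    then obtain r where "r > 0" "cball x r \<subseteq> A" using open_A open_contains_cball by blast
    then show ?thesis using controlled_interior by blast
  next
    case 2
    then obtain r where "r > 0" "ball x r \<subseteq> - closure A" 
      using open_contains_ball[of "- closure A"] by auto
    moreover have "ball x r \<inter> A = {}" using calculation(2) closure_subset by blast
    ultimately show ?thesis using controlled_exterior by blast
  next
    case 3
    then obtain U e \<gamma> where U: "x \<in> U" "lipschitz_chart A U e \<gamma>"
      using lip_A by (auto simp: lipschitz_boundary_def)
    have "x \<in> \<Omega>" using 3 closure_A by (auto simp: frontier_def)
    then have "open (U \<inter> \<Omega>)" "x \<in> U \<inter> \<Omega>" using U open_\<Omega> by (auto simp: lipschitz_chart_def)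
    then obtain s where s: "s > 0" "cball x s \<subseteq> U \<inter> \<Omega>" using open_contains_cball by blast
    then have "controlled (ball x (s / 2))" by (intro controlled_boundary[OF U(2)]) auto
    then show ?thesis using s(1) half_gt_zero by blast
  qed
qed

text \<open>A partition of unity built one ball at a time: as \<open>\<eta>\<close> is 1 on the half
  ball, \<open>(1 - \<eta>) \<phi>\<close> has nonzeros only in \<open>S\<close>, while
  \<open>\<eta> \<phi>\<close> lives in the full ball. Each product costs at most a factor
  \<open>M\<close> in \<open>test_norm\<close>, which explains \<open>\<epsilon> / (2 * M)\<close>;
  the outer norms do not grow.\<close>

lemma controlled_insert:
  assumes "r > 0" "controlled (ball c r)" "controlled S"
  shows "controlled (ball c (r / 2) \<union> S)"
  unfolding controlled_def
proof (intro allI impI)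
  fix \<epsilon> :: real assume \<epsilon>: "\<epsilon> > 0"
  obtain \<eta> where \<eta>: "\<And>k. Ck k \<eta>" "\<And>x. 0 \<le> \<eta> x" "\<And>x. \<eta> x \<le> 1"
    "\<And>x. x \<in> ball c (r / 2) \<Longrightarrow> \<eta> x = 1" "\<And>x. x \<notin> ball c r \<Longrightarrow> \<eta> x = 0"
    using smooth_ball_cutoff_exists[OF assms(1), of c] by metis
  have \<eta>T: "\<eta> \<in> test_functions UNIV"
    by (rule test_functionsI[OF \<eta>(1) compact_cball[of c r]]) (use \<eta>(5) in auto)
  obtain M where M: "M > 0"
    "\<And>\<phi> S. \<phi> \<in> test_functions S \<Longrightarrow> test_norm (\<lambda>x. \<eta> x * \<phi> x) \<le> M * test_norm \<phi>"
    "\<And>\<phi> S. \<phi> \<in> test_functions S \<Longrightarrow> test_norm (\<lambda>x. (1 - \<eta> x) * \<phi> x) \<le> M * test_norm \<phi>"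
    by (rule test_norm_cutoff_le[OF \<eta>T \<eta>(2,3)]) blast
  have \<epsilon>': "\<epsilon> / (2 * M) > 0" using \<epsilon> M(1) by simp
  obtain C1 where C1: "C1 \<ge> 0" "\<And>\<phi>. \<phi> \<in> test_functions \<Omega> \<Longrightarrow> {x. \<phi> x \<noteq> 0} \<subseteq> ball c r \<Longrightarrow>
      \<bar>G \<phi>\<bar> \<le> \<epsilon> / (2 * M) * test_norm \<phi> + C1 * outer_norm \<phi>"
    using assms(2)[unfolded controlled_def, rule_format, OF \<epsilon>'] by blast
  obtain C2 where C2: "C2 \<ge> 0" "\<And>\<phi>. \<phi> \<in> test_functions \<Omega> \<Longrightarrow> {x. \<phi> x \<noteq> 0} \<subseteq> S \<Longrightarrow>
      \<bar>G \<phi>\<bar> \<le> \<epsilon> / (2 * M) * test_norm \<phi> + C2 * outer_norm \<phi>"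
    using assms(3)[unfolded controlled_def, rule_format, OF \<epsilon>'] by blast
  show "\<exists>C\<ge>0. \<forall>\<phi>\<in>test_functions \<Omega>. {x. \<phi> x \<noteq> 0} \<subseteq> ball c (r / 2) \<union> S \<longrightarrow>
      \<bar>G \<phi>\<bar> \<le> \<epsilon> * test_norm \<phi> + C * outer_norm \<phi>"
  proof (intro exI[of _ "C1 + C2"] conjI ballI impI)
    fix \<phi> assume \<phi>: "\<phi> \<in> test_functions \<Omega>" "{x. \<phi> x \<noteq> 0} \<subseteq> ball c (r / 2) \<union> S"
    let ?a = "\<lambda>x. \<eta> x * \<phi> x" and ?b = "\<lambda>x. (1 - \<eta> x) * \<phi> x"
    have a: "?a \<in> test_functions \<Omega>" by (intro test_functions_mult \<phi>(1) \<eta>(1))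
    have b: "?b \<in> test_functions \<Omega>" by (intro test_functions_mult \<phi>(1) \<eta>(1) Ck_diff Ck_const)
    have on: "outer_norm ?a \<le> outer_norm \<phi>" "outer_norm ?b \<le> outer_norm \<phi>"
      unfolding outer_norm_def
      by (rule l2norm_mono[OF outer_L2[OF \<phi>(1)]],
          use \<eta>(2,3) in \<open>simp add: indicator_def abs_mult mult_left_le_one_le\<close>)+
    have sc: "\<epsilon> / (2 * M) * y \<le> \<epsilon> / 2 * z" if "y \<le> M * z" for y z
      using that \<epsilon> M(1) mult_left_mono[OF that, of "\<epsilon> / (2 * M)"] by simp
    have "{x. ?a x \<noteq> 0} \<subseteq> ball c r" using \<eta>(5) by (auto simp del: mem_ball)
    then have "\<bar>G ?a\<bar> \<le> \<epsilon> / (2 * M) * test_norm ?a + C1 * outer_norm ?a" by (rule C1(2)[OF a])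
    also have "\<dots> \<le> \<epsilon> / 2 * test_norm \<phi> + C1 * outer_norm \<phi>"
      using on(1) C1(1) by (intro add_mono sc M(2)[OF \<phi>(1)] mult_left_mono)
    finally have Ga: "\<bar>G ?a\<bar> \<le> \<epsilon> / 2 * test_norm \<phi> + C1 * outer_norm \<phi>" .
    have "{x. ?b x \<noteq> 0} \<subseteq> S" using \<eta>(4) \<phi>(2) by (auto simp del: mem_ball)
    then have "\<bar>G ?b\<bar> \<le> \<epsilon> / (2 * M) * test_norm ?b + C2 * outer_norm ?b" by (rule C2(2)[OF b])
    also have "\<dots> \<le> \<epsilon> / 2 * test_norm \<phi> + C2 * outer_norm \<phi>"
      using on(2) C2(1) by (intro add_mono sc M(3)[OF \<phi>(1)] mult_left_mono)
    finally have Gb: "\<bar>G ?b\<bar> \<le> \<epsilon> / 2 * test_norm \<phi> + C2 * outer_norm \<phi>" .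
    have "G \<phi> = G ?a + G ?b" using G_add[OF a b] by (simp add: algebra_simps)
    then show "\<bar>G \<phi>\<bar> \<le> \<epsilon> * test_norm \<phi> + (C1 + C2) * outer_norm \<phi>"
      using Ga Gb by (simp add: distrib_right)
  qed (use C1 C2 in simp)
qed

text \<open>Every point has a controlled ball, finitely many of the half balls cover the compact set
  \<open>closure \<Omega>\<close>, and they are added one by one.\<close>

lemma functional_bound:
  assumes "\<epsilon> > 0"
  obtains C where "C \<ge> 0"
    "\<And>\<phi>. \<phi> \<in> test_functions \<Omega> \<Longrightarrow> \<bar>G \<phi>\<bar> \<le> \<epsilon> * test_norm \<phi> + C * outer_norm \<phi>"
proof -
  obtain r where r: "\<And>x. r x > 0" "\<And>x. controlled (ball x (r x))"
    using controlled_ball_exists by metis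
  have "compact (closure \<Omega>)" using bounded_\<Omega> by (simp add: compact_closure)
  then obtain C where C: "finite C" "closure \<Omega> \<subseteq> (\<Union>c\<in>C. ball c (r c / 2))"
  proof (rule compactE_image[of _ UNIV "\<lambda>c. ball c (r c / 2)"])
    show "closure \<Omega> \<subseteq> (\<Union>c. ball c (r c / 2))" 
    proof
      fix x show "x \<in> (\<Union>c. ball c (r c / 2))" using r(1)[of x] by (intro UN_I[of x]) auto
    qed
  qed auto
  have "controlled (\<Union>c\<in>C. ball c (r c / 2))" using C(1)
    by (induction C) (simp_all add: controlled_empty controlled_insert r)
  from this[unfolded controlled_def, rule_format, OF assms] obtain K where K: "K \<ge> 0" "\<And>\<phi>. \<phi> \<in> test_functions \<Omega> \<Longrightarrow> {x. \<phi> x \<noteq> 0} \<subseteq> (\<Union>c\<in>C. ball c (r c / 2)) \<Longrightarrow>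
      \<bar>G \<phi>\<bar> \<le> \<epsilon> * test_norm \<phi> + K * outer_norm \<phi>"
    by blast
  show thesis
  proof (rule that[OF K(1)])
    fix \<phi> assume \<phi>: "\<phi> \<in> test_functions \<Omega>"
    then have "{x. \<phi> x \<noteq> 0} \<subseteq> \<Omega>" using test_functions_vanish by blast
    then have "{x. \<phi> x \<noteq> 0} \<subseteq> (\<Union>c\<in>C. ball c (r c / 2))" using C(2) closure_subset by blast
    then show "\<bar>G \<phi>\<bar> \<le> \<epsilon> * test_norm \<phi> + K * outer_norm \<phi>" by (rule K(2)[OF \<phi>])
  qed
qed

end

section \<open>The Dirichlet form on scalar H10 functions\<close>

lemma test_functions_sum:
  "(\<And>i. i \<in> I \<Longrightarrow> \<phi> i \<in> test_functions S) \<Longrightarrow> (\<lambda>x. \<Sum>i\<in>I. \<phi> i x) \<in> test_functions S"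
  by (induction I rule: infinite_finite_induct) (simp_all add: test_functions_add)

definition grad_inner :: "(real ^ 'n) set \<Rightarrow> (real ^ 'n \<Rightarrow> real) \<Rightarrow> (real ^ 'n \<Rightarrow> real) \<Rightarrow> real"
  where "grad_inner \<Omega> u v = (\<Sum>i\<in>UNIV. \<integral>x. weak_partial \<Omega> i u x * weak_partial \<Omega> i v x \<partial>lebesgue_on \<Omega>)"

lemma grad_inner_self:
  "grad_inner \<Omega> u u = (\<Sum>i\<in>UNIV. (l2norm (lebesgue_on \<Omega>) (weak_partial \<Omega> i u))\<^sup>2)"
  unfolding grad_inner_def l2norm_square by (simp add: power2_eq_square)

lemma grad_inner_self_nonneg: "0 \<le> grad_inner \<Omega> u u"
  unfolding grad_inner_self by (intro sum_nonneg) simp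

lemma hs_inner_eq_sum: "hs_inner P Q = (\<Sum>j\<in>UNIV. \<Sum>i\<in>UNIV. P $ i $ j * Q $ i $ j)"
  by (simp add: hs_inner_def trace_def matrix_matrix_mult_def transpose_def)

context bounded_open_set
begin

lemma integral_on_diff:
  fixes f :: "real ^ 'n \<Rightarrow> real"
  assumes "open A"
  shows "(\<integral>x. f x \<partial>lebesgue_on (\<Omega> - A)) = (\<integral>x. indicator (- A) x * f x \<partial>lebesgue_on \<Omega>)"
proof -
  have "\<Omega> - A \<in> sets lebesgue" using assms by (intro sets.Diff sets_\<Omega>) (simp add: sets_completionI_sets)
  moreover have "(\<lambda>x. indicator (\<Omega> - A) x *\<^sub>R f x) = (\<lambda>x. indicator \<Omega> x *\<^sub>R (indicator (- A) x * f x))"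
    by (auto simp: indicator_def fun_eq_iff)
  ultimately show ?thesis by (simp add: integral_restrict_space)
qed

lemma L2_indicator_on:
  assumes "open A" "u \<in> L2 (lebesgue_on \<Omega>)"
  shows "(\<lambda>x. indicator (- A) x * u x) \<in> L2 (lebesgue_on \<Omega>)"
proof -
  have "(\<lambda>x. indicator (- A) x :: real) \<in> borel_measurable (lebesgue_on \<Omega>)"
    using assms(1) by (intro borel_imp_measurable_on borel_measurable_indicator) auto
  moreover have "integrable (lebesgue_on \<Omega>) (\<lambda>x. (indicator (- A) x * u x)\<^sup>2)"
  proof (rule Bochner_Integration.integrable_bound[OF L2_square_integrable[OF assms(2)]])
    show "(\<lambda>x. (indicator (- A) x * u x)\<^sup>2) \<in> borel_measurable (lebesgue_on \<Omega>)"
      using calculation L2_measurable[OF assms(2)] by (intro borel_measurable_power borel_measurable_times)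
  qed (auto simp: indicator_def)
  ultimately show ?thesis
    using L2_measurable[OF assms(2)] by (simp add: L2_def borel_measurable_times)
qed

lemma grad_inner_test_function:
  assumes "w \<in> H1 \<Omega>" "\<phi> \<in> test_functions \<Omega>"
  shows "grad_inner \<Omega> w \<phi> = (\<Sum>i\<in>UNIV. \<integral>x. weak_partial \<Omega> i w x * partial_deriv i \<phi> x \<partial>lebesgue_on \<Omega>)"
  unfolding grad_inner_def
proof (rule sum.cong[OF refl], rule integral_cong_AE)
  fix i
  note [measurable] = L2_measurable[OF weak_partial(1)[OF assms(1), of i]]
    L2_measurable[OF weak_partial(1)[OF test_functions_H1[OF assms(2)], of i]]
    L2_measurable[OF test_functions_L2_on[OF test_functions_partial_deriv[OF assms(2)]], of i]
  show "(\<lambda>x. weak_partial \<Omega> i w x * weak_partial \<Omega> i \<phi> x) \<in> borel_measurable (lebesgue_on \<Omega>)"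
    "(\<lambda>x. weak_partial \<Omega> i w x * partial_deriv i \<phi> x) \<in> borel_measurable (lebesgue_on \<Omega>)" by measurable
  show "AE x in lebesgue_on \<Omega>. weak_partial \<Omega> i w x * weak_partial \<Omega> i \<phi> x = weak_partial \<Omega> i w x * partial_deriv i \<phi> x"
    using weak_partial_test_function[OF assms(2), of i] by eventually_elim simp
qed

lemma grad_inner_zero:
  assumes "w \<in> H1 \<Omega>"
  shows "grad_inner \<Omega> w (\<lambda>x. 0) = 0"
  using grad_inner_test_function[OF assms test_functions_zero] by simp

text \<open>For a test function \<open>\<theta> k\<close> close to \<open>w\<close> in H1,
  integration by parts turns its Dirichlet form with \<open>\<phi>\<close> into an integral of
  \<open>\<phi>\<close> against \<open>q\<close>, minus the Laplacian of \<open>\<theta> k\<close>.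
  The error is controlled by the Cauchy-Schwarz inequality.\<close>

lemma grad_inner_approx:
  assumes "w \<in> H10 \<Omega>" "\<epsilon> > 0"
  shows "\<exists>q \<in> test_functions \<Omega>. \<forall>\<phi> \<in> test_functions \<Omega>.
    \<bar>grad_inner \<Omega> w \<phi> - (\<integral>x. q x * \<phi> x \<partial>lborel)\<bar> \<le> \<epsilon> * test_norm \<phi>"
proof -
  let ?M = "lebesgue_on \<Omega>"
  note w = H10_H1[OF assms(1)]
  obtain \<theta> where \<theta>: "\<And>k. \<theta> k \<in> test_functions \<Omega>"
    "\<And>i. (\<lambda>k. l2norm ?M (\<lambda>x. partial_deriv i (\<theta> k) x - weak_partial \<Omega> i w x)) \<longlonglongrightarrow> 0"
    by (rule H10_approx[OF assms(1)]) blast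
  have "(\<lambda>k. \<Sum>i\<in>UNIV. l2norm ?M (\<lambda>x. partial_deriv i (\<theta> k) x - weak_partial \<Omega> i w x)) \<longlonglongrightarrow> (\<Sum>i\<in>(UNIV::'n set). 0)"
    by (intro tendsto_sum \<theta>(2))
  then have "\<forall>\<^sub>F k in sequentially. (\<Sum>i\<in>UNIV. l2norm ?M (\<lambda>x. partial_deriv i (\<theta> k) x - weak_partial \<Omega> i w x)) < \<epsilon>"
    using assms(2) by (intro order_tendstoD) simp_all
  then obtain k where k: "(\<Sum>i\<in>UNIV. l2norm ?M (\<lambda>x. partial_deriv i (\<theta> k) x - weak_partial \<Omega> i w x)) < \<epsilon>"
    using eventually_happens trivial_limit_sequentially by blast
  let ?d = "\<lambda>i. partial_deriv i (\<theta> k)"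
  have d: "?d i \<in> test_functions \<Omega>" for i by (rule test_functions_partial_deriv[OF \<theta>(1)])
  define q where "q = (\<lambda>x. -1 * (\<Sum>i\<in>UNIV. partial_deriv i (?d i) x))"
  have q: "q \<in> test_functions \<Omega>"
    unfolding q_def by (intro test_functions_mult test_functions_sum test_functions_partial_deriv \<theta>(1) Ck_const)
  show ?thesis
  proof (rule bexI[OF _ q], rule ballI)
    fix \<phi> assume \<phi>: "\<phi> \<in> test_functions \<Omega>"
    note p = test_functions_partial_deriv[OF \<phi>]
    have "(\<integral>x. q x * \<phi> x \<partial>lborel) = (\<integral>x. (\<Sum>i\<in>UNIV. - (partial_deriv i (?d i) x * \<phi> x)) \<partial>lborel)"
      by (simp add: q_def sum_distrib_right sum_negf)
    also have "\<dots> = (\<Sum>i\<in>UNIV. \<integral>x. - (partial_deriv i (?d i) x * \<phi> x) \<partial>lborel)"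
      by (intro Bochner_Integration.integral_sum integrable_minus L2_mult_integrable
          test_functions_L2[OF test_functions_partial_deriv[OF d]] test_functions_L2[OF \<phi>])
    also have "\<dots> = (\<Sum>i\<in>UNIV. \<integral>x. ?d i x * partial_deriv i \<phi> x \<partial>?M)"
    proof (rule sum.cong[OF refl])
      fix i
      have "(\<integral>x. ?d i x * partial_deriv i \<phi> x \<partial>?M) = (\<integral>x. ?d i x * partial_deriv i \<phi> x \<partial>lborel)"
        using test_functions_borel[OF d[of i]] test_functions_borel[OF p[of i]] test_functions_vanish[OF p[of i]]
        by (intro integral_on_\<Omega>) auto
      then show "(\<integral>x. - (partial_deriv i (?d i) x * \<phi> x) \<partial>lborel) = (\<integral>x. ?d i x * partial_deriv i \<phi> x \<partial>?M)"
        using integral_by_parts[OF \<phi> test_functions_Ck[OF d[of i]], of i] by simp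
    qed
    finally have "grad_inner \<Omega> w \<phi> - (\<integral>x. q x * \<phi> x \<partial>lborel)
      = (\<Sum>i\<in>UNIV. (\<integral>x. weak_partial \<Omega> i w x * partial_deriv i \<phi> x \<partial>?M) - (\<integral>x. ?d i x * partial_deriv i \<phi> x \<partial>?M))"
      by (simp add: grad_inner_test_function[OF w \<phi>] sum_subtractf)
    also have "\<bar>\<dots>\<bar> \<le> (\<Sum>i\<in>UNIV. l2norm ?M (\<lambda>x. ?d i x - weak_partial \<Omega> i w x) * test_norm \<phi>)"
    proof (intro order_trans[OF sum_abs] sum_mono)
      fix i
      note L = weak_partial(1)[OF w, of i] test_functions_L2_on[OF d[of i]] test_functions_L2_on[OF p[of i]]
      have "(\<integral>x. weak_partial \<Omega> i w x * partial_deriv i \<phi> x \<partial>?M) - (\<integral>x. ?d i x * partial_deriv i \<phi> x \<partial>?M)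
        = - (\<integral>x. (?d i x - weak_partial \<Omega> i w x) * partial_deriv i \<phi> x \<partial>?M)"
        using L2_mult_integrable[OF L(1,3)] L2_mult_integrable[OF L(2,3)] by (simp add: left_diff_distrib)
      also have "\<bar>\<dots>\<bar> \<le> l2norm ?M (\<lambda>x. ?d i x - weak_partial \<Omega> i w x) * l2norm ?M (partial_deriv i \<phi>)"
        using L2_cauchy_schwarz[OF L2_diff[OF L(2,1)] L(3)] by simp
      also have "l2norm ?M (partial_deriv i \<phi>) \<le> test_norm \<phi>"
        unfolding l2norm_test_function[OF p] unfolding l2norm_def test_norm_def
        by (intro real_sqrt_le_mono add_increasing member_le_sum) auto
      finally show "\<bar>(\<integral>x. weak_partial \<Omega> i w x * partial_deriv i \<phi> x \<partial>?M) - (\<integral>x. ?d i x * partial_deriv i \<phi> x \<partial>?M)\<bar>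
        \<le> l2norm ?M (\<lambda>x. ?d i x - weak_partial \<Omega> i w x) * test_norm \<phi>"
        by (simp add: mult_left_mono)
    qed
    also have "\<dots> \<le> \<epsilon> * test_norm \<phi>"
      unfolding sum_distrib_right[symmetric] using k by (intro mult_right_mono) simp_all
    finally show "\<bar>grad_inner \<Omega> w \<phi> - (\<integral>x. q x * \<phi> x \<partial>lborel)\<bar> \<le> \<epsilon> * test_norm \<phi>" .
  qed
qed

text \<open>The energy identity controls gradients but no L2 norm over \<open>A\<close>, so the full
  \<open>test_norm\<close> has to be traded for the gradient norm.\<close>

lemma poincare_test_norm:
  obtains P where "P > 0" "\<And>\<phi>. \<phi> \<in> test_functions \<Omega> \<Longrightarrow>
    test_norm \<phi> \<le> P * sqrt (\<Sum>i\<in>UNIV. (l2norm (lebesgue_on \<Omega>) (partial_deriv i \<phi>))\<^sup>2)"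
proof -
  obtain R where R: "R > 0" "\<Omega> \<subseteq> cball 0 R"
    using bounded_\<Omega> unfolding bounded_pos by (auto simp: subset_eq)
  show thesis
  proof (rule that[of "sqrt (4 * R\<^sup>2 + 1)"])
    fix \<phi> assume \<phi>: "\<phi> \<in> test_functions \<Omega>"
    let ?J = "\<lambda>i. \<integral>x. (partial_deriv i \<phi> x)\<^sup>2 \<partial>lborel"
    have J: "(\<Sum>i\<in>UNIV. (l2norm (lebesgue_on \<Omega>) (partial_deriv i \<phi>))\<^sup>2) = (\<Sum>i\<in>UNIV. ?J i)"
      by (simp add: l2norm_test_function[OF test_functions_partial_deriv[OF \<phi>]] l2norm_square)
    have "?J i \<le> (\<Sum>i\<in>UNIV. ?J i)" for i by (intro member_le_sum) auto
    then have "4 * R\<^sup>2 * ?J i \<le> 4 * R\<^sup>2 * (\<Sum>i\<in>UNIV. ?J i)" for i by (intro mult_left_mono) auto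
    then have "(\<integral>x. (\<phi> x)\<^sup>2 \<partial>lborel) \<le> 4 * R\<^sup>2 * (\<Sum>i\<in>UNIV. ?J i)"
      using poincare_test_functions[OF \<phi> R] order_trans by blast
    then have "(test_norm \<phi>)\<^sup>2 \<le> (4 * R\<^sup>2 + 1) * (\<Sum>i\<in>UNIV. ?J i)"
      by (simp add: test_norm_square algebra_simps)
    then have "test_norm \<phi> \<le> sqrt ((4 * R\<^sup>2 + 1) * (\<Sum>i\<in>UNIV. ?J i))" by (rule real_le_rsqrt)
    then show "test_norm \<phi> \<le> sqrt (4 * R\<^sup>2 + 1) * sqrt (\<Sum>i\<in>UNIV. (l2norm (lebesgue_on \<Omega>) (partial_deriv i \<phi>))\<^sup>2)"
      unfolding J by (simp add: real_sqrt_mult)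
  qed (simp add: add_nonneg_pos)
qed

text \<open>The localised estimate is applied to the Dirichlet part alone. The integral over
  \<open>\<Omega> - A\<close> is at most the L2 norm of \<open>w\<close> times the L2 norm of
  \<open>u\<close> on \<open>\<Omega> - A\<close>, so it is absorbed into \<open>C\<close>; it
  vanishes for test functions of \<open>A\<close>, so the hypothesis on these yields
  \<open>G_A\<close>. The bound then passes to \<open>H10 \<Omega>\<close> by density, all its terms
  being continuous in the H1 norm.\<close>

lemma interior_vanishing_functional_bound:
  assumes A: "open A" "closure A \<subseteq> \<Omega>" "lipschitz_boundary A" and w: "w \<in> H10 \<Omega>" and \<epsilon>: "\<epsilon> > 0"
    and 0: "\<And>\<phi>. \<phi> \<in> test_functions A \<Longrightarrow>
      grad_inner \<Omega> w \<phi> + (\<integral>x. w x * \<phi> x \<partial>lebesgue_on (\<Omega> - A)) = 0"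
  obtains C where "C \<ge> 0" "\<And>u. u \<in> H10 \<Omega> \<Longrightarrow>
    \<bar>grad_inner \<Omega> w u + (\<integral>x. w x * u x \<partial>lebesgue_on (\<Omega> - A))\<bar>
      \<le> \<epsilon> * sqrt (grad_inner \<Omega> u u) + C * l2norm (lebesgue_on (\<Omega> - A)) u"
proof -
  let ?M = "lebesgue_on \<Omega>"
  let ?o = "\<lambda>u x. indicator (- A) x * u x"
  let ?g = "\<lambda>\<phi>. sqrt (\<Sum>i\<in>UNIV. (l2norm ?M (partial_deriv i \<phi>))\<^sup>2)"
  note w1 = H10_H1[OF w]
  have A\<Omega>: "A \<subseteq> \<Omega>" using A(2) closure_subset by blast
  have norm_o: "l2norm (lebesgue_on (\<Omega> - A)) u = l2norm ?M (?o u)" for u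
  proof -
    have "(\<lambda>x. indicator (- A) x * (u x)\<^sup>2) = (\<lambda>x. (?o u x)\<^sup>2)" by (auto simp: indicator_def fun_eq_iff)
    then show ?thesis by (simp add: l2norm_def integral_on_diff[OF A(1)])
  qed
  have int_o: "(\<integral>x. w x * u x \<partial>lebesgue_on (\<Omega> - A)) = (\<integral>x. ?o w x * u x \<partial>?M)" for u
    by (simp add: integral_on_diff[OF A(1)] mult.assoc)
  interpret localized_functional \<Omega> A "grad_inner \<Omega> w"
  proof
    fix \<phi> \<psi> assume \<phi>: "\<phi> \<in> test_functions \<Omega>" and \<psi>: "\<psi> \<in> test_functions \<Omega>"
    have "partial_deriv i (\<lambda>x. \<phi> x + \<psi> x) = (\<lambda>x. partial_deriv i \<phi> x + partial_deriv i \<psi> x)" for i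
      by (rule ext, rule partial_deriv_add) (rule test_functions_differentiable[OF \<phi>] test_functions_differentiable[OF \<psi>])+
    moreover have "integrable ?M (\<lambda>x. weak_partial \<Omega> i w x * partial_deriv i \<phi> x)" 
      "integrable ?M (\<lambda>x. weak_partial \<Omega> i w x * partial_deriv i \<psi> x)" for i
      by (intro L2_mult_integrable weak_partial(1)[OF w1] test_functions_L2_on test_functions_partial_deriv \<phi> \<psi>)+
    ultimately show "grad_inner \<Omega> w (\<lambda>x. \<phi> x + \<psi> x) = grad_inner \<Omega> w \<phi> + grad_inner \<Omega> w \<psi>"
      by (simp add: grad_inner_test_function[OF w1] \<phi> \<psi> test_functions_add distrib_left sum.distrib)
  next
    fix \<phi> assume \<phi>: "\<phi> \<in> test_functions A"
    have "(\<lambda>x. ?o w x * \<phi> x) = (\<lambda>x. 0)"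
      using test_functions_vanish[OF \<phi>] by (auto simp: indicator_def fun_eq_iff)
    then show "grad_inner \<Omega> w \<phi> = 0" using 0[OF \<phi>] unfolding int_o by simp
  qed (use A grad_inner_approx[OF w] in auto)
  obtain P where P: "P > 0" "\<And>\<phi>. \<phi> \<in> test_functions \<Omega> \<Longrightarrow> test_norm \<phi> \<le> P * ?g \<phi>"
    by (rule poincare_test_norm) blast
  \<comment> \<open>Dividing by \<open>P\<close> in advance compensates for the Poincare
    constant.\<close>
  obtain C where C: "C \<ge> 0"
    "\<And>\<phi>. \<phi> \<in> test_functions \<Omega> \<Longrightarrow> \<bar>grad_inner \<Omega> w \<phi>\<bar> \<le> \<epsilon> / P * test_norm \<phi> + C * outer_norm \<phi>"
    using functional_bound[of "\<epsilon> / P"] \<epsilon> P(1) by (metis divide_pos_pos)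
  let ?C = "C + l2norm ?M w"
  have test: "\<bar>grad_inner \<Omega> w \<phi> + (\<integral>x. ?o w x * \<phi> x \<partial>?M)\<bar> \<le> \<epsilon> * ?g \<phi> + ?C * l2norm ?M (?o \<phi>)"
    if \<phi>: "\<phi> \<in> test_functions \<Omega>" for \<phi>
  proof -
    have "\<epsilon> / P * test_norm \<phi> \<le> \<epsilon> / P * (P * ?g \<phi>)"
      using P(2)[OF \<phi>] \<epsilon> P(1) by (intro mult_left_mono) auto
    then have "\<epsilon> / P * test_norm \<phi> \<le> \<epsilon> * ?g \<phi>" using P(1) by simp
    moreover have "outer_norm \<phi> = l2norm ?M (?o \<phi>)"
    proof -
      have "(\<lambda>x. (?o \<phi> x)\<^sup>2) \<in> borel_measurable borel"
        using test_functions_borel[OF \<phi>] A(1)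
        by (intro borel_measurable_power borel_measurable_times borel_measurable_indicator) auto
      then show ?thesis
        using test_functions_vanish[OF \<phi>] unfolding outer_norm_def l2norm_def by (subst integral_on_\<Omega>) auto
    qed
    moreover have "\<bar>\<integral>x. ?o w x * \<phi> x \<partial>?M\<bar> \<le> l2norm ?M w * l2norm ?M (?o \<phi>)"
    proof -
      have "(\<lambda>x. ?o w x * \<phi> x) = (\<lambda>x. w x * ?o \<phi> x)" by (simp add: fun_eq_iff)
      then show ?thesis
        using L2_cauchy_schwarz[OF H1_L2[OF w1] L2_indicator_on[OF A(1) test_functions_L2_on[OF \<phi>]]] by simp
    qed
    ultimately show ?thesis using C(2)[OF \<phi>] by (simp add: distrib_right)
  qed
  show thesis
  proof (rule that[of ?C])
    fix u assume u: "u \<in> H10 \<Omega>"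
    obtain \<phi> where \<phi>: "\<And>k. \<phi> k \<in> test_functions \<Omega>"
      "(\<lambda>k. l2norm ?M (\<lambda>x. \<phi> k x - u x)) \<longlonglongrightarrow> 0"
      "\<And>i. (\<lambda>k. l2norm ?M (\<lambda>x. partial_deriv i (\<phi> k) x - weak_partial \<Omega> i u x)) \<longlonglongrightarrow> 0"
      by (rule H10_approx[OF u]) blast
    note L = test_functions_L2_on[OF \<phi>(1)] test_functions_L2_on[OF test_functions_partial_deriv[OF \<phi>(1)]]
      H1_L2[OF H10_H1[OF u]] weak_partial(1)[OF H10_H1[OF u]]
    have 1: "(\<lambda>k. grad_inner \<Omega> w (\<phi> k)) \<longlonglongrightarrow> grad_inner \<Omega> w u"
      unfolding grad_inner_test_function[OF w1 \<phi>(1)] unfolding grad_inner_def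
      by (intro tendsto_sum L2_tendsto_inner weak_partial(1)[OF w1] L \<phi>(3))
    have 2: "(\<lambda>k. \<integral>x. ?o w x * \<phi> k x \<partial>?M) \<longlonglongrightarrow> (\<integral>x. ?o w x * u x \<partial>?M)"
      by (intro L2_tendsto_inner L2_indicator_on[OF A(1)] H1_L2[OF w1] L \<phi>(2))
    have 3: "(\<lambda>k. ?g (\<phi> k)) \<longlonglongrightarrow> sqrt (grad_inner \<Omega> u u)"
      unfolding grad_inner_self by (intro tendsto_intros L2_tendsto_norm L \<phi>(3))
    have 4: "(\<lambda>k. l2norm ?M (?o (\<phi> k))) \<longlonglongrightarrow> l2norm ?M (?o u)"
    proof (rule L2_tendsto_norm)
      show "(\<lambda>k. l2norm ?M (\<lambda>x. ?o (\<phi> k) x - ?o u x)) \<longlonglongrightarrow> 0"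
      proof (rule Lim_null_comparison[OF _ \<phi>(2)], intro always_eventually allI)
        fix k
        have "l2norm ?M (\<lambda>x. ?o (\<phi> k) x - ?o u x) \<le> l2norm ?M (\<lambda>x. \<phi> k x - u x)"
          by (intro l2norm_mono L2_diff L) (simp add: indicator_def)
        then show "norm (l2norm ?M (\<lambda>x. ?o (\<phi> k) x - ?o u x)) \<le> l2norm ?M (\<lambda>x. \<phi> k x - u x)" by simp
      qed
    qed (intro L2_indicator_on[OF A(1)] L)+
    show "\<bar>grad_inner \<Omega> w u + (\<integral>x. w x * u x \<partial>lebesgue_on (\<Omega> - A))\<bar>
      \<le> \<epsilon> * sqrt (grad_inner \<Omega> u u) + ?C * l2norm (lebesgue_on (\<Omega> - A)) u"
      unfolding int_o norm_o
    proof (rule LIMSEQ_le)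
      show "(\<lambda>k. \<bar>grad_inner \<Omega> w (\<phi> k) + (\<integral>x. ?o w x * \<phi> k x \<partial>?M)\<bar>)
        \<longlonglongrightarrow> \<bar>grad_inner \<Omega> w u + (\<integral>x. ?o w x * u x \<partial>?M)\<bar>"
        by (intro tendsto_rabs tendsto_add 1 2)
      show "(\<lambda>k. \<epsilon> * ?g (\<phi> k) + ?C * l2norm ?M (?o (\<phi> k)))
        \<longlonglongrightarrow> \<epsilon> * sqrt (grad_inner \<Omega> u u) + ?C * l2norm ?M (?o u)"
        by (intro tendsto_add tendsto_mult tendsto_const 3 4)
      show "\<exists>N. \<forall>k\<ge>N. \<bar>grad_inner \<Omega> w (\<phi> k) + (\<integral>x. ?o w x * \<phi> k x \<partial>?M)\<bar>
        \<le> \<epsilon> * ?g (\<phi> k) + ?C * l2norm ?M (?o (\<phi> k))"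
        using test[OF \<phi>(1)] by blast
    qed
  qed (use C(1) in simp)
qed

end

section \<open>Vector fields and their components\<close>

context bounded_open_set
begin

lemma H10_inner_eq_sum:
  assumes "\<And>j. (\<lambda>x. u x $ j) \<in> H1 \<Omega>" "\<And>j. (\<lambda>x. v x $ j) \<in> H1 \<Omega>"
  shows "H10_inner \<Omega> u v = (\<Sum>j\<in>UNIV. grad_inner \<Omega> (\<lambda>x. u x $ j) (\<lambda>x. v x $ j))"
  unfolding H10_inner_def hs_inner_eq_sum weak_grad_def grad_inner_def
  by (simp add: Bochner_Integration.integral_sum Bochner_Integration.integrable_sum
      L2_mult_integrable weak_partial(1) assms)

lemma L2_on_diff:
  assumes "open A" "u \<in> L2 (lebesgue_on \<Omega>)"
  shows "u \<in> L2 (lebesgue_on (\<Omega> - A))"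
proof -
  have s: "\<Omega> - A \<in> sets lebesgue" using assms(1) by (intro sets.Diff sets_\<Omega>) (simp add: sets_completionI_sets)
  have "(\<lambda>x. indicator (\<Omega> - A) x *\<^sub>R (u x)\<^sup>2) = (\<lambda>x. indicator \<Omega> x *\<^sub>R (indicator (- A) x * u x)\<^sup>2)"
    by (auto simp: indicator_def fun_eq_iff)
  then have "integrable (lebesgue_on (\<Omega> - A)) (\<lambda>x. (u x)\<^sup>2)"
    using L2_square_integrable[OF L2_indicator_on[OF assms]] s by (simp add: integrable_restrict_space)
  moreover have "u \<in> borel_measurable (lebesgue_on (\<Omega> - A))"
    using L2_measurable[OF assms(2)] by (rule measurable_restrict_mono) auto
  ultimately show ?thesis by (simp add: L2_def)
qed

text \<open>A coarse Cauchy-Schwarz inequality: the second factor is a sum of component norms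
  instead of \<open>H10_norm \<Omega> v\<close>. It is meant for a fixed field \<open>v\<close> and
  varying \<open>u\<close>, where only the independence of this factor from \<open>u\<close>
  matters.\<close>

lemma H10_inner_bound:
  assumes "\<And>j. (\<lambda>x. u x $ j) \<in> H1 \<Omega>" "\<And>j. (\<lambda>x. v x $ j) \<in> H1 \<Omega>"
  shows "\<bar>H10_inner \<Omega> u v\<bar> \<le> H10_norm \<Omega> u *
    (\<Sum>j\<in>UNIV. \<Sum>i\<in>UNIV. l2norm (lebesgue_on \<Omega>) (weak_partial \<Omega> i (\<lambda>x. v x $ j)))"
proof -
  let ?M = "lebesgue_on \<Omega>"
  have *: "l2norm ?M (weak_partial \<Omega> i (\<lambda>x. u x $ j)) \<le> H10_norm \<Omega> u" for i j
  proof -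
    have "(l2norm ?M (weak_partial \<Omega> i (\<lambda>x. u x $ j)))\<^sup>2 \<le> grad_inner \<Omega> (\<lambda>x. u x $ j) (\<lambda>x. u x $ j)"
      unfolding grad_inner_self by (intro member_le_sum) auto
    also have "\<dots> \<le> H10_inner \<Omega> u u"
      unfolding H10_inner_eq_sum[OF assms(1) assms(1)]
      by (rule member_le_sum) (auto simp: grad_inner_self_nonneg)
    finally show ?thesis unfolding H10_norm_def by (rule real_le_rsqrt)
  qed
  show ?thesis
    unfolding H10_inner_eq_sum[OF assms] grad_inner_def sum_distrib_left
  proof (intro order_trans[OF sum_abs] sum_mono)
    fix i j
    have "\<bar>\<integral>x. weak_partial \<Omega> i (\<lambda>x. u x $ j) x * weak_partial \<Omega> i (\<lambda>x. v x $ j) x \<partial>?M\<bar>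
      \<le> l2norm ?M (weak_partial \<Omega> i (\<lambda>x. u x $ j)) * l2norm ?M (weak_partial \<Omega> i (\<lambda>x. v x $ j))"
      by (intro L2_cauchy_schwarz weak_partial(1) assms)
    also have "\<dots> \<le> H10_norm \<Omega> u * l2norm ?M (weak_partial \<Omega> i (\<lambda>x. v x $ j))"
      by (intro mult_right_mono *) simp
    finally show "\<bar>\<integral>x. weak_partial \<Omega> i (\<lambda>x. u x $ j) x * weak_partial \<Omega> i (\<lambda>x. v x $ j) x \<partial>?M\<bar>
      \<le> H10_norm \<Omega> u * l2norm ?M (weak_partial \<Omega> i (\<lambda>x. v x $ j))" .
  qed
qed

lemma H10_norm_scaleR:
  assumes "\<And>j. (\<lambda>x. u x $ j) \<in> H1 \<Omega>" "c \<ge> 0"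
  shows "H10_norm \<Omega> (\<lambda>x. c *\<^sub>R u x) = c * H10_norm \<Omega> u"
proof -
  let ?M = "lebesgue_on \<Omega>"
  have c: "(\<lambda>x. (c *\<^sub>R u x) $ j) = (\<lambda>x. c * u x $ j)" for j by simp
  have H: "(\<lambda>x. c * u x $ j) \<in> H1 \<Omega>" for j
    using H1_lincomb[OF assms(1) assms(1), of c j 0 j] by simp
  have "l2norm ?M (weak_partial \<Omega> i (\<lambda>x. c * u x $ j)) = l2norm ?M (\<lambda>x. c * weak_partial \<Omega> i (\<lambda>x. u x $ j) x)" for i j
    by (intro l2norm_cong_AE weak_partial_cmult L2_measurable L2_cmult weak_partial(1) H assms(1))
  then have "(l2norm ?M (weak_partial \<Omega> i (\<lambda>x. c * u x $ j)))\<^sup>2 = c\<^sup>2 * (l2norm ?M (weak_partial \<Omega> i (\<lambda>x. u x $ j)))\<^sup>2" for i j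
    by (simp add: l2norm_square power_mult_distrib)
  then have "H10_inner \<Omega> (\<lambda>x. c *\<^sub>R u x) (\<lambda>x. c *\<^sub>R u x) = c\<^sup>2 * H10_inner \<Omega> u u"
    by (subst (1 2) H10_inner_eq_sum) (simp_all add: H assms(1) grad_inner_self sum_distrib_left)
  then show ?thesis using assms(2) by (simp add: H10_norm_def real_sqrt_mult)
qed

end

section \<open>Traces and the energy estimate\<close>

text \<open>If a sequence approximates \<open>w + v\<close>, subtracting \<open>v\<close> from it
  yields one that approximates \<open>w\<close>. As \<open>v\<close> vanishes
  \<open>\<sigma>\<close>-almost everywhere, this leaves the L2 distances to \<open>g\<close> on the
  boundary unchanged.\<close>

lemma has_boundary_trace_add:
  assumes v: "v \<in> test_functions \<Omega>" "AE x in \<sigma>. v x = 0" and \<sigma>: "sets \<sigma> = sets borel"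
    and tr: "has_boundary_trace \<Omega> \<sigma> w g"
  shows "has_boundary_trace \<Omega> \<sigma> (\<lambda>x. w x + v x) g"
  unfolding has_boundary_trace_def
proof (intro conjI allI impI)
  show g: "g \<in> L2 \<sigma>" using tr by (simp add: has_boundary_trace_def)
  fix \<phi> assume \<phi>: "(\<forall>k. \<phi> k \<in> test_functions \<Omega>) \<and> H1_tendsto \<Omega> \<phi> (\<lambda>x. w x + v x)"
  have "(\<lambda>x. \<phi> k x - v x) \<in> test_functions \<Omega>" for k
    using \<phi> test_functions_diff[OF _ v(1)] by blast
  moreover have "H1_tendsto \<Omega> (\<lambda>k x. \<phi> k x - v x) w"
    using \<phi> by (simp add: H1_tendsto_def algebra_simps)
  ultimately have lim: "(\<lambda>k. \<integral>x. (\<phi> k x - v x - g x)\<^sup>2 \<partial>\<sigma>) \<longlonglongrightarrow> 0"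
    using tr[unfolded has_boundary_trace_def, THEN conjunct2, rule_format, of "\<lambda>k x. \<phi> k x - v x"] by simp
  have m: "f \<in> borel_measurable \<sigma>" if "f \<in> test_functions \<Omega>" for f
    using test_functions_borel[OF that] measurable_cong_sets[OF \<sigma> refl] by blast
  have "(\<integral>x. (\<phi> k x - v x - g x)\<^sup>2 \<partial>\<sigma>) = (\<integral>x. (\<phi> k x - g x)\<^sup>2 \<partial>\<sigma>)" for k
  proof (rule integral_cong_AE)
    have "\<phi> k \<in> test_functions \<Omega>" using \<phi> by blast
    note [measurable] = m[OF this] m[OF v(1)] L2_measurable[OF g]
    show "(\<lambda>x. (\<phi> k x - v x - g x)\<^sup>2) \<in> borel_measurable \<sigma>" "(\<lambda>x. (\<phi> k x - g x)\<^sup>2) \<in> borel_measurable \<sigma>"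
      by measurable
    show "AE x in \<sigma>. (\<phi> k x - v x - g x)\<^sup>2 = (\<phi> k x - g x)\<^sup>2"
      using v(2) by eventually_elim simp
  qed
  with lim show "(\<lambda>k. \<integral>x. (\<phi> k x - g x)\<^sup>2 \<partial>\<sigma>) \<longlonglongrightarrow> 0" by simp
qed

text \<open>The two functions have the same candidate traces, so \<open>SOME\<close> picks the same one, whether or not a
  trace exists.\<close>

lemma boundary_trace_interior_test_function:
  assumes u: "u \<in> test_functions A" and A: "open A" "A \<subseteq> \<Omega>"
    and \<sigma>: "sets \<sigma> = sets borel" "emeasure \<sigma> (- frontier A) = 0"
  shows "boundary_trace \<Omega> \<sigma> u = boundary_trace \<Omega> \<sigma> (\<lambda>x. 0)"
proof -
  have "- frontier A \<in> null_sets \<sigma>" using \<sigma> by (simp add: null_sets_def)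
  then have "AE x in \<sigma>. x \<notin> - frontier A" by (rule AE_not_in)
  then have ae: "AE x in \<sigma>. u x = 0"
  proof eventually_elim
    case (elim x)
    then have "x \<notin> A" using A(1) by (auto simp: frontier_def interior_open)
    then show ?case by (rule test_functions_vanish[OF u])
  qed
  have u\<Omega>: "u \<in> test_functions \<Omega>" by (rule test_functions_mono[OF u A(2)])
  have "has_boundary_trace \<Omega> \<sigma> u g = has_boundary_trace \<Omega> \<sigma> (\<lambda>x. 0) g" for g
  proof
    assume "has_boundary_trace \<Omega> \<sigma> u g"
    from has_boundary_trace_add[OF test_functions_diff[OF test_functions_zero u\<Omega>] _ \<sigma>(1) this] ae
    show "has_boundary_trace \<Omega> \<sigma> (\<lambda>x. 0) g" by simp
  next
    assume "has_boundary_trace \<Omega> \<sigma> (\<lambda>x. 0) g"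
    from has_boundary_trace_add[OF u\<Omega> ae \<sigma>(1) this]
    show "has_boundary_trace \<Omega> \<sigma> u g" by simp
  qed
  then show ?thesis by (simp add: boundary_trace_def)
qed

text \<open>Completing the square in \<open>Y\<close> leaves
  \<open>a X^2 - \<epsilon> X \<le> C^2 / 4\<close>, and multiplication by \<open>a\<close> turns
  this into \<open>(a X) (a X - \<epsilon>) \<le> a C^2 / 4\<close>. If the claim failed, both
  factors would exceed the square root of the right-hand side.\<close>

lemma energy_bound:
  fixes a X Y \<epsilon> C :: real
  assumes "a > 0" "X \<ge> 0" "\<epsilon> \<ge> 0" and "a * X\<^sup>2 + Y\<^sup>2 \<le> \<epsilon> * X + C * Y"
  shows "a * X \<le> \<epsilon> + sqrt (a * C\<^sup>2 / 4)"
proof (rule ccontr)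
  let ?r = "sqrt (a * C\<^sup>2 / 4)"
  assume "\<not> a * X \<le> \<epsilon> + ?r"
  then have *: "a * X > ?r" "a * X - \<epsilon> > ?r" using assms(3) by auto
  have r: "?r \<ge> 0" "?r * ?r = a * C\<^sup>2 / 4" using assms(1) by auto
  have "0 \<le> (Y - C / 2)\<^sup>2" by simp
  then have "C * Y - Y\<^sup>2 \<le> C\<^sup>2 / 4" by (simp add: power2_eq_square algebra_simps)
  then have "a * X\<^sup>2 - \<epsilon> * X \<le> C\<^sup>2 / 4" using assms(4) by simp
  then have "a * (a * X\<^sup>2 - \<epsilon> * X) \<le> a * (C\<^sup>2 / 4)" using assms(1) by (intro mult_left_mono) auto
  moreover have "a * (a * X\<^sup>2 - \<epsilon> * X) = (a * X) * (a * X - \<epsilon>)" by (simp add: power2_eq_square algebra_simps)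
  moreover have "?r * ?r < (a * X) * (a * X - \<epsilon>)" using * r(1) by (intro mult_strict_mono') auto
  ultimately show False using r(2) by simp
qed

theorem theorem1:
  fixes A \<Omega> :: "(real ^ 'n) set"
    and \<sigma> :: "(real ^ 'n) measure"
    and n :: "real ^ 'n \<Rightarrow> real ^ 'n"
    and s :: "real \<Rightarrow> real ^ 'n \<Rightarrow> real ^ 'n"
  assumes "CARD('n) \<ge> 2"
    and "open A" and "bounded A" and "open \<Omega>" and "bounded \<Omega>"
    and "closure A \<subseteq> \<Omega>"
    and "lipschitz_boundary A"
    and "is_surface_measure A \<sigma>"
    and "is_outward_normal_field A \<sigma> n"
    and "\<And>a. a > 0 \<Longrightarrow> s a \<in> H10_vec \<Omega>"
    and "\<And>a \<phi>. a > 0 \<Longrightarrow> \<phi> \<in> H10_vec \<Omega> \<Longrightarrow>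
           a * (\<integral>x. hs_inner (weak_grad \<Omega> (s a) x) (weak_grad \<Omega> \<phi> x) \<partial>lebesgue_on \<Omega>)
             + (\<integral>x. s a x \<bullet> \<phi> x \<partial>lebesgue_on (\<Omega> - A))
           = (\<integral>x. n x \<bullet> boundary_trace_vec \<Omega> \<sigma> \<phi> x \<partial>\<sigma>)"
  shows "(\<forall>\<phi> \<in> H10_vec \<Omega>.
           ((\<lambda>a. \<integral>x. s a x \<bullet> \<phi> x \<partial>lebesgue_on (\<Omega> - A)) \<longlongrightarrow>
             (\<integral>x. n x \<bullet> boundary_trace_vec \<Omega> \<sigma> \<phi> x \<partial>\<sigma>)) (at_right 0))
       \<and> ((\<lambda>a. H10_norm \<Omega> (\<lambda>x. a *\<^sub>R s a x)) \<longlongrightarrow> 0) (at_right 0)"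
proof -
  interpret bounded_open_set \<Omega> using assms(4,5) by unfold_locales
  let ?D = "lebesgue_on (\<Omega> - A)"
  define F where "F \<phi> = (\<integral>x. n x \<bullet> boundary_trace_vec \<Omega> \<sigma> \<phi> x \<partial>\<sigma>)" for \<phi>
  have eq: "a * H10_inner \<Omega> (s a) \<phi> + (\<integral>x. s a x \<bullet> \<phi> x \<partial>?D) = F \<phi>"
    if "a > 0" "\<phi> \<in> H10_vec \<Omega>" for a \<phi>
    using assms(11)[OF that] by (simp add: F_def H10_inner_def)
  have comp: "(\<lambda>x. \<phi> x $ j) \<in> H10 \<Omega>" "(\<lambda>x. \<phi> x $ j) \<in> H1 \<Omega>" "(\<lambda>x. \<phi> x $ j) \<in> L2 ?D"
    if "\<phi> \<in> H10_vec \<Omega>" for \<phi> j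
    using that H10_H1 L2_on_diff[OF assms(2) H1_L2] by (auto simp: H10_vec_def)
  define w where "w = s 1"
  have w: "w \<in> H10_vec \<Omega>" unfolding w_def by (rule assms(10)) simp
  \<comment> \<open>The contribution of the \<open>j\<close>-th component to \<open>F\<close>. It is
    expressed through \<open>w\<close> alone, makes sense for any scalar \<open>u\<close> and does
    not mention traces, which brings \<open>F\<close> within reach of the scalar estimate.\<close>
  define H where "H j u = grad_inner \<Omega> (\<lambda>x. w x $ j) u + (\<integral>x. w x $ j * u x \<partial>?D)" for j u
  have F_sum: "F \<phi> = (\<Sum>j\<in>UNIV. H j (\<lambda>x. \<phi> x $ j))" if "\<phi> \<in> H10_vec \<Omega>" for \<phi>
    using eq[OF _ that, of 1]
    by (simp add: H_def H10_inner_eq_sum integral_inner_eq_sum comp w that sum.distrib w_def[symmetric])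
  have H0: "H j (\<lambda>x. 0) = 0" for j
    by (simp add: H_def grad_inner_zero comp(2)[OF w])
  have H_A: "H j u = 0" if u: "u \<in> test_functions A" for j u
  proof -
    \<comment> \<open>Placing \<open>u\<close> in slot \<open>j\<close> and zero elsewhere isolates
      \<open>H j u\<close> in the sum for \<open>F\<close>.\<close>
    let ?\<phi> = "\<lambda>x. \<chi> k. if k = j then u x else 0"
    have A\<Omega>: "A \<subseteq> \<Omega>" using assms(6) closure_subset by blast
    have "(\<lambda>x. if k = j then u x else 0) \<in> H10 \<Omega>" for k
      using test_functions_H10[OF test_functions_mono[OF u A\<Omega>]] test_functions_H10[OF test_functions_zero]
      by (cases "k = j") simp_all
    then have \<phi>: "?\<phi> \<in> H10_vec \<Omega>" by (simp add: H10_vec_def)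
    have "boundary_trace \<Omega> \<sigma> u = boundary_trace \<Omega> \<sigma> (\<lambda>x. 0)"
      using assms(8) by (intro boundary_trace_interior_test_function[OF u assms(2) A\<Omega>]) (auto simp: is_surface_measure_def)
    then have "boundary_trace \<Omega> \<sigma> (\<lambda>y. if k = j then u y else 0) = boundary_trace \<Omega> \<sigma> (\<lambda>x. 0)" for k
      by (cases "k = j") simp_all
    then have "boundary_trace_vec \<Omega> \<sigma> ?\<phi> = boundary_trace_vec \<Omega> \<sigma> (\<lambda>x. 0)"
      by (simp add: boundary_trace_vec_def fun_eq_iff vec_eq_iff)
    then have "F ?\<phi> = F (\<lambda>x. 0)" by (simp add: F_def)
    \<comment> \<open>Read off from the representation of \<open>F\<close> by \<open>w\<close>: the
      trace of the zero function is itself a \<open>SOME\<close> term, so its value is not at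
      hand.\<close>
    moreover have "F (\<lambda>x. 0) = 0"
      using F_sum[of "\<lambda>x. 0"] test_functions_H10[OF test_functions_zero] by (simp add: H10_vec_def H0)
    moreover have "F ?\<phi> = (\<Sum>k\<in>UNIV. if k = j then H j u else 0)"
      unfolding F_sum[OF \<phi>] by (intro sum.cong) (auto simp: H0)
    ultimately show ?thesis by simp
  qed
  have main: "((\<lambda>a. a * H10_norm \<Omega> (s a)) \<longlongrightarrow> 0) (at_right 0)"
  proof (rule tendstoI)
    fix e :: real assume e: "e > 0"
    \<comment> \<open>The \<open>CARD('n)\<close> components contribute \<open>\<epsilon>\<close>
      each and \<open>e / 2\<close> together, which leaves the other half of \<open>e\<close> for
      the term with \<open>C\<close>.\<close>
    define \<epsilon> where "\<epsilon> = e / (2 * real CARD('n))"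
    have \<epsilon>: "\<epsilon> > 0" "real CARD('n) * \<epsilon> = e / 2" using e by (auto simp: \<epsilon>_def)
    have "\<exists>C\<ge>0. \<forall>u \<in> H10 \<Omega>. \<bar>H j u\<bar> \<le> \<epsilon> * sqrt (grad_inner \<Omega> u u) + C * l2norm ?D u" for j
    proof -
      obtain C where "C \<ge> 0" "\<And>u. u \<in> H10 \<Omega> \<Longrightarrow> \<bar>H j u\<bar> \<le> \<epsilon> * sqrt (grad_inner \<Omega> u u) + C * l2norm ?D u"
        unfolding H_def
        by (rule interior_vanishing_functional_bound
            [OF assms(2,6,7) comp(1)[OF w, of j] \<epsilon>(1) H_A[unfolded H_def]]) blast+
      then show ?thesis by blast
    qed
    then obtain c where c: "\<And>j. c j \<ge> 0"
      "\<And>j u. u \<in> H10 \<Omega> \<Longrightarrow> \<bar>H j u\<bar> \<le> \<epsilon> * sqrt (grad_inner \<Omega> u u) + c j * l2norm ?D u" by metis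
    define C where "C = (\<Sum>j\<in>UNIV. c j)"
    \<comment> \<open>\<open>C\<close> depends on \<open>e\<close> but not on \<open>a\<close>, so
      the square root tends to zero with \<open>a\<close>. The inequality comes from testing the
      equation with \<open>s a\<close> itself.\<close>
    have bound: "a * H10_norm \<Omega> (s a) \<le> e / 2 + sqrt (a * C\<^sup>2 / 4)" if a: "a > 0" for a
    proof -
      note sa = assms(10)[OF a]
      let ?u = "\<lambda>j x. s a x $ j"
      define Y where "Y = sqrt (\<Sum>j\<in>UNIV. (l2norm ?D (?u j))\<^sup>2)"
      have X2: "H10_inner \<Omega> (s a) (s a) = (\<Sum>j\<in>UNIV. grad_inner \<Omega> (?u j) (?u j))"
        by (rule H10_inner_eq_sum) (rule comp(2)[OF sa])+
      have "(H10_norm \<Omega> (s a))\<^sup>2 = H10_inner \<Omega> (s a) (s a)"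
        unfolding H10_norm_def X2 by (intro real_sqrt_pow2 sum_nonneg grad_inner_self_nonneg)
      moreover have "Y\<^sup>2 = (\<integral>x. s a x \<bullet> s a x \<partial>?D)"
        unfolding Y_def integral_inner_eq_sum[OF comp(3)[OF sa] comp(3)[OF sa]]
        by (simp add: sum_nonneg l2norm_square flip: power2_eq_square)
      ultimately have "a * (H10_norm \<Omega> (s a))\<^sup>2 + Y\<^sup>2 = F (s a)"
        using eq[OF a sa] by simp
      also have "\<dots> \<le> (\<Sum>j\<in>UNIV. \<epsilon> * H10_norm \<Omega> (s a) + c j * Y)"
        unfolding F_sum[OF sa]
      proof (rule sum_mono)
        fix j
        have "H j (?u j) \<le> \<epsilon> * sqrt (grad_inner \<Omega> (?u j) (?u j)) + c j * l2norm ?D (?u j)"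
          using c(2)[OF comp(1)[OF sa, of j], of j] by simp
        also have "\<dots> \<le> \<epsilon> * H10_norm \<Omega> (s a) + c j * Y"
        proof (intro add_mono mult_left_mono)
          show "sqrt (grad_inner \<Omega> (?u j) (?u j)) \<le> H10_norm \<Omega> (s a)"
            unfolding H10_norm_def X2
            by (intro real_sqrt_le_mono member_le_sum[of j UNIV "\<lambda>j. grad_inner \<Omega> (?u j) (?u j)"])
              (auto simp: grad_inner_self_nonneg)
          have "(l2norm ?D (?u j))\<^sup>2 \<le> (\<Sum>j\<in>UNIV. (l2norm ?D (?u j))\<^sup>2)"
            by (intro member_le_sum[of j UNIV "\<lambda>j. (l2norm ?D (?u j))\<^sup>2"]) auto
          then show "l2norm ?D (?u j) \<le> Y" unfolding Y_def by (rule real_le_rsqrt)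
        qed (use c(1) \<epsilon>(1) in auto)
        finally show "H j (?u j) \<le> \<epsilon> * H10_norm \<Omega> (s a) + c j * Y" .
      qed
      also have "\<dots> = e / 2 * H10_norm \<Omega> (s a) + C * Y"
        by (simp add: sum.distrib sum_distrib_right[symmetric] C_def \<epsilon>(2)[symmetric])
      finally show ?thesis
        using a e by (intro energy_bound) (auto simp: H10_norm_def X2 sum_nonneg grad_inner_self_nonneg)
    qed
    have "((\<lambda>a. sqrt (a * C\<^sup>2 / 4)) \<longlongrightarrow> sqrt (0 * C\<^sup>2 / 4)) (at_right 0)"
      by (intro tendsto_intros) simp
    then have "\<forall>\<^sub>F a in at_right 0. sqrt (a * C\<^sup>2 / 4) < e / 2"
      using e by (intro order_tendstoD) auto
    then show "\<forall>\<^sub>F a in at_right 0. dist (a * H10_norm \<Omega> (s a)) 0 < e"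
      using eventually_at_right_less[of 0]
    proof eventually_elim
      case (elim a)
      have "0 \<le> H10_norm \<Omega> (s a)"
        by (simp add: H10_norm_def H10_inner_eq_sum[OF comp(2) comp(2)] assms(10) elim sum_nonneg grad_inner_self_nonneg)
      then show ?case using bound[OF elim(2)] elim by simp
    qed
  qed
  show ?thesis
  proof (intro conjI ballI)
    fix \<phi> assume \<phi>: "\<phi> \<in> H10_vec \<Omega>"
    define K where "K = (\<Sum>j\<in>UNIV. \<Sum>i\<in>UNIV. l2norm (lebesgue_on \<Omega>) (weak_partial \<Omega> i (\<lambda>x. \<phi> x $ j)))"
    \<comment> \<open>By the equation the difference is \<open>- a\<close> times
      \<open>H10_inner \<Omega> (s a) \<phi>\<close>, so for fixed \<open>\<phi>\<close> it is
      bounded by a multiple of \<open>a * H10_norm \<Omega> (s a)\<close>: the strong convergence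
      implies the weak statement.\<close>
    have "((\<lambda>a. (\<integral>x. s a x \<bullet> \<phi> x \<partial>?D) - F \<phi>) \<longlongrightarrow> 0) (at_right 0)"
    proof (rule Lim_null_comparison)
      show "\<forall>\<^sub>F a in at_right 0. norm ((\<integral>x. s a x \<bullet> \<phi> x \<partial>?D) - F \<phi>) \<le> a * H10_norm \<Omega> (s a) * K"
        using eventually_at_right_less[of 0]
      proof eventually_elim
        case (elim a)
        have "(\<integral>x. s a x \<bullet> \<phi> x \<partial>?D) - F \<phi> = - (a * H10_inner \<Omega> (s a) \<phi>)"
          using eq[OF elim \<phi>] by simp
        then show ?case
          using H10_inner_bound[OF comp(2)[OF assms(10)[OF elim]] comp(2)[OF \<phi>]] elim
          by (simp add: abs_mult K_def[symmetric])
      qed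
      show "((\<lambda>a. a * H10_norm \<Omega> (s a) * K) \<longlongrightarrow> 0) (at_right 0)"
        by (rule tendsto_mult_left_zero[OF main])
    qed
    then show "((\<lambda>a. \<integral>x. s a x \<bullet> \<phi> x \<partial>?D) \<longlongrightarrow> (\<integral>x. n x \<bullet> boundary_trace_vec \<Omega> \<sigma> \<phi> x \<partial>\<sigma>)) (at_right 0)"
      unfolding F_def by (rule LIM_zero_cancel)
  next
    show "((\<lambda>a. H10_norm \<Omega> (\<lambda>x. a *\<^sub>R s a x)) \<longlongrightarrow> 0) (at_right 0)"
    proof (rule Lim_transform_eventually[OF main])
      show "\<forall>\<^sub>F a in at_right 0. a * H10_norm \<Omega> (s a) = H10_norm \<Omega> (\<lambda>x. a *\<^sub>R s a x)"
        using eventually_at_right_less[of 0]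
        by eventually_elim (simp add: H10_norm_scaleR comp(2) assms(10))
    qed
  qed
qed

end
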